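(* Let $k\ge 1$, $t\ge 0$ and $\ell$ with $1\le \ell\le k$ be integers such that $|\ell+t-k|\le 1$. Then the graph $K(k,t;\ell)$ is matching unique except when $$(k,t,\ell)\in\{(2,1,1),(2,1,2),(2,2,1),(3,0,2),(3,1,1),(3,1,2),(3,2,2),(3,0,3),(4,1,2),(4,3,1)\},$$ in which cases it is not matching unique.
   Context: All graphs are finite, simple and undirected. For a graph $G$ of order $n$ (number of vertices), $m(G,k)$ is the number of $k$-matchings (sets of $k$ pairwise nonincident edges), $m(G,0)=1$, and the matching polynomial of $G$ is $\mu(G,x)=\sum_{k\ge 0}(-1)^k m(G,k)x^{n-2k}$. Two nonisomorphic graphs with the same matching polynomial are comatching. A graph $G$ is matching unique if it has no comatching graph, i.e. every graph $H$ (connected or not) with $\mu(H,x)=\mu(G,x)$ is isomorphic to $G$. $K(k,t;\ell)$ ($k\ge 1$, $t\ge 0$, $1\le \ell\le k$) is the graph obtained from the disjoint union of a star $K_{1,k}$ and $t$ isolated vertices by adding a new vertex $u$ and joining $u$ to all $t$ isolated vertices and to exactly $\ell$ leaves of $K_{1,k}$, but not to the center of $K_{1,k}$ (for $K_{1,1}$ one vertex is regarded as the center and the other as the leaf). *)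

theory Defs
  imports
    "HOL-Computational_Algebra.Polynomial"
    "HOL-Library.Disjoint_Sets"
begin

record 'a sgraph =
  verts :: "'a set"
  edges :: "'a set set"

definition finite_simple_graph :: "'a sgraph \<Rightarrow> bool" where
  "finite_simple_graph G \<longleftrightarrow>
     finite (verts G) \<and> (\<forall>e\<in>edges G. e \<subseteq> verts G \<and> card e = 2)"

definition isomorphic :: "'a sgraph \<Rightarrow> 'b sgraph \<Rightarrow> bool" where
  "isomorphic G H \<longleftrightarrow>
     (\<exists>f. bij_betw f (verts G) (verts H) \<and>
       (\<forall>u\<in>verts G. \<forall>v\<in>verts G. {u, v} \<in> edges G \<longleftrightarrow> {f u, f v} \<in> edges H))"

definition matchings :: "'a sgraph \<Rightarrow> nat \<Rightarrow> 'a set set set" where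
  "matchings G k = {M. M \<subseteq> edges G \<and> card M = k \<and> disjoint M}"

definition num_matchings :: "'a sgraph \<Rightarrow> nat \<Rightarrow> nat" where
  "num_matchings G k = card (matchings G k)"

(* A k-matching covers 2 k vertices, so all terms with 2 k > n vanish; cutting the sum off
   there also means that the natural-number subtraction n - 2 * k never truncates. *)
definition matching_poly :: "'a sgraph \<Rightarrow> int poly" where
  "matching_poly G = (let n = card (verts G) in
     \<Sum>k\<le>n div 2. monom ((-1) ^ k * int (num_matchings G k)) (n - 2 * k))"

definition comatching :: "'a sgraph \<Rightarrow> 'b sgraph \<Rightarrow> bool" where
  "comatching G H \<longleftrightarrow> \<not> isomorphic G H \<and> matching_poly H = matching_poly G"

(* A definition cannot quantify over types. Every finite graph has an isomorphic copy with
   vertices in nat, so H ranges over those; see matching_uniqueD for arbitrary vertex types. *)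
definition matching_unique :: "'a sgraph \<Rightarrow> bool" where
  "matching_unique G \<longleftrightarrow>
     \<not> (\<exists>H :: nat sgraph. finite_simple_graph H \<and> comatching G H)"

(* Hub is the added vertex u; the Pendant j are the t isolated vertices. *)
datatype K_vertex = Center | Leaf nat | Hub | Pendant nat

definition K_graph :: "nat \<Rightarrow> nat \<Rightarrow> nat \<Rightarrow> K_vertex sgraph" where
  "K_graph k t l =
     \<lparr> verts = {Center, Hub} \<union> Leaf ` {1..k} \<union> Pendant ` {1..t},
       edges = {{Center, Leaf i} | i. i \<in> {1..k}}
             \<union> {{Hub, Pendant j} | j. j \<in> {1..t}}
             \<union> {{Hub, Leaf i} | i. i \<in> {1..l}} \<rparr>"

lemma finite_simple_graph_K_graph:
  assumes "l \<le> k"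
  shows "finite_simple_graph (K_graph k t l)"
  using assms by (auto simp: finite_simple_graph_def K_graph_def)

lemma isomorphic_trans:
  assumes "isomorphic G H" "isomorphic H K"
  shows "isomorphic G K"
proof -
  obtain f where f: "bij_betw f (verts G) (verts H)"
    "\<forall>u\<in>verts G. \<forall>v\<in>verts G. {u, v} \<in> edges G \<longleftrightarrow> {f u, f v} \<in> edges H"
    using assms(1) unfolding isomorphic_def by blast
  obtain g where g: "bij_betw g (verts H) (verts K)"
    "\<forall>u\<in>verts H. \<forall>v\<in>verts H. {u, v} \<in> edges H \<longleftrightarrow> {g u, g v} \<in> edges K"
    using assms(2) unfolding isomorphic_def by blast
  have "f u \<in> verts H" if "u \<in> verts G" for u
    using f(1) that bij_betwE by blast
  then have "\<forall>u\<in>verts G. \<forall>v\<in>verts G. {u, v} \<in> edges G \<longleftrightarrow> {(g \<circ> f) u, (g \<circ> f) v} \<in> edges K"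
    using f(2) g(2) by simp
  then show ?thesis
    using bij_betw_trans[OF f(1) g(1)] unfolding isomorphic_def by blast
qed

lemma nat_copy:
  fixes H :: "'b sgraph"
  assumes H: "finite_simple_graph H"
  obtains H' :: "nat sgraph" where
    "finite_simple_graph H'" "matching_poly H' = matching_poly H" "isomorphic H' H"
proof -
  have fin: "finite (verts H)" and E: "\<And>e. e \<in> edges H \<Longrightarrow> e \<subseteq> verts H \<and> card e = 2"
    using H by (auto simp: finite_simple_graph_def)
  obtain h :: "'b \<Rightarrow> nat" where h: "inj_on h (verts H)"
    using finite_imp_inj_to_nat_seg[OF fin] by blast
  define H' where "H' = \<lparr> verts = h ` verts H, edges = (`) h ` edges H \<rparr>"
  have inj2: "inj_on ((`) h) (edges H)"
    using inj_on_image_Pow[OF h] by (rule inj_on_subset) (use E in blast)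
  have "card (h ` e) = 2" if "e \<in> edges H" for e
    using E[OF that] card_image[OF inj_on_subset[OF h]] by metis
  then have fsg: "finite_simple_graph H'"
    using fin E by (auto simp: finite_simple_graph_def H'_def)
  have disj: "disjoint ((`) h ` M) \<longleftrightarrow> disjoint M" if "M \<subseteq> edges H" for M
  proof -
    have *: "h ` a \<inter> h ` b = {} \<longleftrightarrow> a \<inter> b = {}" "h ` a = h ` b \<longleftrightarrow> a = b"
      if "a \<in> M" "b \<in> M" for a b
    proof -
      have ab: "a \<subseteq> verts H" "b \<subseteq> verts H" using that \<open>M \<subseteq> edges H\<close> E by auto
      show "h ` a \<inter> h ` b = {} \<longleftrightarrow> a \<inter> b = {}"
        using inj_on_image_Int[OF h ab] by auto
      show "h ` a = h ` b \<longleftrightarrow> a = b"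
        by (rule inj_on_image_eq_iff[OF h ab])
    qed
    show ?thesis
      unfolding disjoint_def using * by (simp add: ball_simps)
  qed
  have num: "num_matchings H' k = num_matchings H k" for k
  proof -
    have "matchings H' k = (`) ((`) h) ` matchings H k"
    proof (intro equalityI subsetI)
      fix N assume N: "N \<in> matchings H' k"
      then obtain M where M: "M \<subseteq> edges H" "N = (`) h ` M"
        by (auto simp: matchings_def H'_def subset_image_iff)
      then show "N \<in> (`) ((`) h) ` matchings H k"
        using N disj[OF M(1)] card_image[OF inj_on_subset[OF inj2 M(1)]]
        by (auto simp: matchings_def)
    next
      fix N assume "N \<in> (`) ((`) h) ` matchings H k"
      then obtain M where M: "M \<in> matchings H k" "N = (`) h ` M" by blast
      then have "M \<subseteq> edges H" by (simp add: matchings_def)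
      then show "N \<in> matchings H' k"
        using M disj card_image[OF inj_on_subset[OF inj2]]
        by (auto simp: matchings_def H'_def)
    qed
    moreover have "inj_on ((`) ((`) h)) (matchings H k)"
      using inj_on_image_Pow[OF inj2] by (rule inj_on_subset) (auto simp: matchings_def)
    ultimately show ?thesis
      by (simp add: num_matchings_def card_image)
  qed
  have cardV: "card (verts H') = card (verts H)"
    by (simp add: H'_def card_image[OF h])
  have poly: "matching_poly H' = matching_poly H"
    by (simp add: matching_poly_def num cardV)
  have iso: "isomorphic H' H"
    unfolding isomorphic_def
  proof (intro exI conjI ballI)
    let ?g = "the_inv_into (verts H) h"
    show "bij_betw ?g (verts H') (verts H)"
      by (simp add: H'_def bij_betw_the_inv_into inj_on_imp_bij_betw h)
    fix u v assume uv: "u \<in> verts H'" "v \<in> verts H'"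
    then obtain a b where ab: "a \<in> verts H" "b \<in> verts H" "u = h a" "v = h b"
      by (auto simp: H'_def)
    have "e = {a, b}" if "e \<in> edges H" "{h a, h b} = h ` e" for e
    proof -
      have "h ` e = h ` {a, b}" using that by simp
      then show ?thesis using inj_on_image_eq_iff[OF h, of e "{a, b}"] E[OF that(1)] ab by blast
    qed
    then have "{u, v} \<in> edges H' \<longleftrightarrow> {a, b} \<in> edges H"
      by (auto simp: H'_def ab image_iff)
    then show "{u, v} \<in> edges H' \<longleftrightarrow> {?g u, ?g v} \<in> edges H"
      by (simp add: ab the_inv_into_f_f[OF h])
  qed
  from that[OF fsg poly iso] show ?thesis .
qed

lemma matching_uniqueD:
  fixes G :: "'a sgraph" and H :: "'b sgraph"
  assumes "matching_unique G" "finite_simple_graph H" "matching_poly H = matching_poly G"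
  shows "isomorphic G H"
proof -
  obtain H' :: "nat sgraph" where H': "finite_simple_graph H'"
    "matching_poly H' = matching_poly H" "isomorphic H' H"
    using nat_copy[OF assms(2)] by blast
  then have "isomorphic G H'"
    using assms(1,3) unfolding matching_unique_def comatching_def by metis
  then show ?thesis
    using H'(3) isomorphic_trans by blast
qed

end

theory Submission
  imports Defs
begin

text \<open>
Write b = l + t for the degree of the hub. Every edge of K(k, t; l) meets the center or the hub, so
this graph has no 3-matching, and its matching polynomial records exactly the number k + t + 2 of
vertices, the number k + b of edges and the number k b - l of 2-matchings. A comatching graph H
is therefore a graph with these three numbers and without a 3-matching.

Graphs without three disjoint edges have few shapes (\<open>shape_if_no_three_disjoint_edges\<close>): two
vertices u, v meet all edges; or every edge contains a vertex v or lies in a triple T; or all edges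
lie in two disjoint triples; or all edges lie in a set of five vertices.

In the first shape H is isomorphic to K(k, t; l). If u and v are not adjacent, have degrees p and q
and have c common neighbours, then p + q = k + b and p q - c = k b - l. There are enough vertices
only if c \<ge> l, hence p q \<ge> k b. As k and b differ by at most one, their product is maximal for
their sum, so {p, q} = {k, b} and c = l, which leaves no isolated vertex and determines H. If u
and v are adjacent, the same count shows that H is a path with at most three edges, which has a
nonadjacent cover as well.

In the other shapes, provided that no two vertices meet all edges, the numbers leave only the ten exceptions.
A star at v together with a full triangle on T has d + 3 edges and 3 d - 2 s 2-matchings, where d is
the degree of v and s the number of its neighbours in T. Equating them gives
(k - 3) (b - 3) = l - 2 s, while the number of vertices gives l \<le> s + 1; this is
solved by seven triples. Two full triangles have nine 2-matchings, one too many for any l \<ge> 1. On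
five vertices the identity 2 m2 + (sum of squared degrees) = m^2 + m bounds the number m2 of
2-matchings from above, because a sum of squares of five integers with a given sum is bounded from below,
and only exceptional triples survive.

Conversely, each exceptional triple has a comatching graph which no two vertices cover: a star with
a triangle, a five-cycle with an isolated vertex, or a five-cycle with a chord.
\<close>

section \<open>Counting matchings\<close>

lemma finite_edges: "finite_simple_graph G \<Longrightarrow> finite (edges G)"
  unfolding finite_simple_graph_def by (rule finite_subset[of _ "Pow (verts G)"]) auto

lemma finite_matchings: "finite (edges G) \<Longrightarrow> finite (matchings G k)"
  by (rule finite_subset[of _ "Pow (edges G)"]) (auto simp: matchings_def)

lemma num_matchings_eq_0_iff:
  "finite (edges G) \<Longrightarrow> num_matchings G k = 0 \<longleftrightarrow> matchings G k = {}"
  by (simp add: num_matchings_def finite_matchings)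

lemma num_matchings_0: "finite (edges G) \<Longrightarrow> num_matchings G 0 = 1"
proof -
  assume "finite (edges G)"
  then have "matchings G 0 = {{}}"
    by (auto simp: matchings_def card_eq_0_iff dest: finite_subset)
  then show ?thesis by (simp add: num_matchings_def)
qed

lemma num_matchings_1: "num_matchings G (Suc 0) = card (edges G)"
proof -
  have "matchings G (Suc 0) = (\<lambda>e. {e}) ` edges G"
    by (auto simp: matchings_def card_Suc_eq disjoint_def)
  then show ?thesis by (simp add: num_matchings_def card_image)
qed

text \<open>
A k-matching covers 2 k vertices. This holds for any set F that contains all edges, so isolated
vertices of G do not spoil the bound.
\<close>
lemma num_matchings_zero_if_few_vertices:
  assumes "finite F" "\<And>e. e \<in> edges G \<Longrightarrow> e \<subseteq> F \<and> card e = 2" "card F < 2 * k"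
  shows "num_matchings G k = 0"
proof -
  have "False" if M: "M \<in> matchings G k" for M
  proof -
    have ME: "M \<subseteq> edges G" "card M = k" "disjoint M" using M by (auto simp: matchings_def)
    have fin: "finite e" if "e \<in> edges G" for e
      using assms(1,2) that finite_subset by blast
    have "card (\<Union>M) = (\<Sum>e\<in>M. card e)"
      by (rule card_Union_disjoint)
        (use ME fin in \<open>auto simp: pairwise_def disjoint_def disjnt_def\<close>)
    also have "\<dots> = 2 * k" using ME assms(2) by (simp add: subset_iff)
    finally have "2 * k \<le> card F"
      using card_mono[OF assms(1), of "\<Union>M"] ME assms(2) by auto
    then show False using assms(3) by simp
  qed
  then show ?thesis unfolding num_matchings_def by (metis card.empty equals0I)
qed

text \<open>
The exponents n - 2 k are pairwise distinct, so no two matching numbers are mixed in a coefficient.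
\<close>
lemma coeff_matching_poly:
  "j \<le> card (verts G) div 2 \<Longrightarrow>
     coeff (matching_poly G) (card (verts G) - 2 * j) = (-1) ^ j * int (num_matchings G j)"
proof -
  assume j: "j \<le> card (verts G) div 2"
  let ?n = "card (verts G)"
  have "coeff (matching_poly G) (?n - 2 * j) =
      (\<Sum>i\<le>?n div 2. if j = i then (-1) ^ i * int (num_matchings G i) else 0)"
    unfolding matching_poly_def Let_def coeff_sum
    by (rule sum.cong[OF refl]) (use j in \<open>auto simp: coeff_monom\<close>)
  then show ?thesis using j by simp
qed

lemma degree_matching_poly:
  assumes "finite_simple_graph G"
  shows "degree (matching_poly G) = card (verts G)"
proof (rule antisym)
  show "degree (matching_poly G) \<le> card (verts G)"
    unfolding matching_poly_def Let_def
    by (rule degree_sum_le) (auto intro: order_trans[OF degree_monom_le])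
  have "coeff (matching_poly G) (card (verts G)) = 1"
    using coeff_matching_poly[of 0 G] num_matchings_0[OF finite_edges[OF assms]] by simp
  then show "card (verts G) \<le> degree (matching_poly G)"
    by (intro le_degree) simp
qed

text \<open>
The leading term is x^n because there is one empty matching, so the polynomial determines n; then the
coefficients give the matching numbers up to n div 2, and all later ones vanish.
\<close>
lemma matching_poly_eq_iff:
  assumes G: "finite_simple_graph G" and H: "finite_simple_graph H"
  shows "matching_poly H = matching_poly G \<longleftrightarrow>
    card (verts H) = card (verts G) \<and> (\<forall>j. num_matchings H j = num_matchings G j)"
proof
  assume eq: "matching_poly H = matching_poly G"
  have n: "card (verts H) = card (verts G)"
    using degree_matching_poly[OF G] degree_matching_poly[OF H] eq by simp
  have "num_matchings H j = num_matchings G j" for j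
  proof (cases "j \<le> card (verts G) div 2")
    case True
    then show ?thesis
      using coeff_matching_poly[of j G] coeff_matching_poly[of j H] eq n by simp
  next
    case False
    have "num_matchings G j = 0"
      by (rule num_matchings_zero_if_few_vertices[of "verts G"])
        (use False G in \<open>auto simp: finite_simple_graph_def\<close>)
    moreover have "num_matchings H j = 0"
      by (rule num_matchings_zero_if_few_vertices[of "verts H"])
        (use False H n in \<open>auto simp: finite_simple_graph_def\<close>)
    ultimately show ?thesis by simp
  qed
  then show "card (verts H) = card (verts G) \<and> (\<forall>j. num_matchings H j = num_matchings G j)"
    using n by simp
qed (simp add: matching_poly_def)

text \<open>
Ordered pairs of disjoint edges are easier to count than 2-matchings, since they form a part of a
cartesian product.
\<close>
definition disjoint_pairs :: "'a set set \<Rightarrow> 'a set set \<Rightarrow> ('a set \<times> 'a set) set" where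
  "disjoint_pairs A B = {(e, f) \<in> A \<times> B. e \<inter> f = {}}"

lemma twice_num_matchings_2:
  assumes fin: "finite (edges G)" and ne: "\<And>e. e \<in> edges G \<Longrightarrow> card e = 2"
  shows "2 * num_matchings G 2 = card (disjoint_pairs (edges G) (edges G))"
proof -
  let ?D = "disjoint_pairs (edges G) (edges G)"
  let ?g = "\<lambda>(e, f). {e, f}"
  have nonempty: "e \<noteq> {}" if "e \<in> edges G" for e using ne[OF that] by auto
  have finD: "finite ?D"
    by (rule finite_subset[of _ "edges G \<times> edges G"]) (use fin in \<open>auto simp: disjoint_pairs_def\<close>)
  have "?g ` ?D \<subseteq> matchings G 2"
  proof
    fix M assume "M \<in> ?g ` ?D"
    then obtain e f where ef: "M = {e, f}" "e \<in> edges G" "f \<in> edges G" "e \<inter> f = {}"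
      by (auto simp: disjoint_pairs_def)
    then have "e \<noteq> f" using nonempty by auto
    then show "M \<in> matchings G 2" using ef by (auto simp: matchings_def disjoint_def Int_commute)
  qed
  then have "card ?D = (\<Sum>M\<in>matchings G 2. \<Sum>p | p \<in> ?D \<and> ?g p = M. 1)"
    using sum.group[OF finD finite_matchings[OF fin], of ?g 2 "\<lambda>_. 1::nat"] by simp
  also have "\<dots> = (\<Sum>M\<in>matchings G 2. 2)"
  proof (rule sum.cong[OF refl])
    fix M assume M: "M \<in> matchings G 2"
    then obtain e f where ef: "M = {e, f}" "e \<noteq> f"
      by (auto simp: matchings_def card_2_iff)
    then have "(e, f) \<in> ?D" "(f, e) \<in> ?D"
      using M by (auto simp: disjoint_pairs_def matchings_def disjoint_def)
    then have "{p. p \<in> ?D \<and> ?g p = M} = {(e, f), (f, e)}"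
      unfolding ef by (auto simp only: doubleton_eq_iff split: prod.splits)
    then show "(\<Sum>p | p \<in> ?D \<and> ?g p = M. 1) = (2::nat)" using ef by simp
  qed
  finally show ?thesis by (simp add: num_matchings_def)
qed

text \<open>
Handshake lemma and its quadratic form. For edges e and f the number of vertices in e \<inter> f is 2, 1
or 0 according to whether they are equal, adjacent or disjoint; summing
[e \<inter> f = {}] + |e \<inter> f| = 1 + [e = f] over all ordered pairs gives the second identity.
\<close>
lemma degree_sums:
  assumes "finite F" and E: "\<And>e. e \<in> edges G \<Longrightarrow> e \<subseteq> F \<and> card e = 2"
  defines "d \<equiv> \<lambda>x. card {e \<in> edges G. x \<in> e}"
  shows "(\<Sum>x\<in>F. d x) = 2 * card (edges G)"
    and "2 * num_matchings G 2 + (\<Sum>x\<in>F. (d x)\<^sup>2) = (card (edges G))\<^sup>2 + card (edges G)"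
proof -
  let ?E = "edges G"
  have fin: "finite ?E"
    by (rule finite_subset[of _ "Pow F"]) (use assms in auto)
  have dsum: "d x = (\<Sum>e\<in>?E. of_bool (x \<in> e))" for x
    using fin by (simp add: d_def sum.inter_filter[symmetric] of_bool_def)
  have cardsum: "(\<Sum>x\<in>F. of_bool (x \<in> e)) = card e" if "e \<subseteq> F" for e :: "'a set"
    using that \<open>finite F\<close> by (simp add: of_bool_def sum.If_cases Int_absorb1)
  have "(\<Sum>x\<in>F. d x) = (\<Sum>e\<in>?E. \<Sum>x\<in>F. of_bool (x \<in> e))"
    unfolding dsum by (rule sum.swap)
  also have "\<dots> = (\<Sum>e\<in>?E. 2)"
    by (rule sum.cong[OF refl]) (use cardsum E in auto)
  finally show "(\<Sum>x\<in>F. d x) = 2 * card ?E" by simp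
  have "(\<Sum>x\<in>F. (d x)\<^sup>2) = (\<Sum>x\<in>F. \<Sum>p\<in>?E \<times> ?E. of_bool (x \<in> fst p \<inter> snd p))"
    unfolding dsum power2_eq_square sum_product sum.cartesian_product
    by (intro sum.cong refl) auto
  also have "\<dots> = (\<Sum>p\<in>?E \<times> ?E. \<Sum>x\<in>F. of_bool (x \<in> fst p \<inter> snd p))"
    by (rule sum.swap)
  also have "\<dots> = (\<Sum>p\<in>?E \<times> ?E. card (fst p \<inter> snd p))"
  proof (intro sum.cong refl cardsum)
    fix p assume "p \<in> ?E \<times> ?E"
    then have "fst p \<in> ?E" by auto
    then show "fst p \<inter> snd p \<subseteq> F" using E by blast
  qed
  finally have squares: "(\<Sum>x\<in>F. (d x)\<^sup>2) = (\<Sum>p\<in>?E \<times> ?E. card (fst p \<inter> snd p))" .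
  have disj: "2 * num_matchings G 2 = (\<Sum>p\<in>?E \<times> ?E. of_bool (fst p \<inter> snd p = {}))"
  proof -
    have "disjoint_pairs ?E ?E = {p \<in> ?E \<times> ?E. fst p \<inter> snd p = {}}"
      by (auto simp: disjoint_pairs_def)
    then show ?thesis
      using twice_num_matchings_2[OF fin] E fin
      by (simp add: sum.inter_filter[symmetric] of_bool_def)
  qed
  have "2 * num_matchings G 2 + (\<Sum>x\<in>F. (d x)\<^sup>2) =
      (\<Sum>p\<in>?E \<times> ?E. of_bool (fst p \<inter> snd p = {}) + card (fst p \<inter> snd p))"
    unfolding squares disj by (simp add: sum.distrib)
  also have "\<dots> = (\<Sum>p\<in>?E \<times> ?E. 1 + of_bool (fst p = snd p))"
  proof (rule sum.cong[OF refl])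
    fix p assume p: "p \<in> ?E \<times> ?E"
    obtain e f where ef: "p = (e, f)" by fastforce
    then have "card e = 2" "card f = 2" using p E by auto
    then obtain a b c d where "e = {a, b}" "a \<noteq> b" "f = {c, d}" "c \<noteq> d" by (metis card_2_iff)
    then show "of_bool (fst p \<inter> snd p = {}) + card (fst p \<inter> snd p) = 1 + of_bool (fst p = snd p)"
      unfolding ef by (auto simp: doubleton_eq_iff Int_insert_left)
  qed
  also have "\<dots> = (card ?E)\<^sup>2 + card {p \<in> ?E \<times> ?E. fst p = snd p}"
    unfolding sum.distrib using fin
    by (simp add: power2_eq_square card_cartesian_product sum.inter_filter[symmetric] of_bool_def)
  also have "{p \<in> ?E \<times> ?E. fst p = snd p} = (\<lambda>e. (e, e)) ` ?E" by auto
  also have "card \<dots> = card ?E" by (simp add: card_image inj_on_def)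
  finally show "2 * num_matchings G 2 + (\<Sum>x\<in>F. (d x)\<^sup>2) = (card ?E)\<^sup>2 + card ?E" .
qed

definition intersecting :: "'a set set \<Rightarrow> bool" where
  "intersecting A \<longleftrightarrow> (\<forall>e\<in>A. \<forall>f\<in>A. e \<inter> f \<noteq> {})"

text \<open>
A matching contains at most one edge of an intersecting family, so a graph whose edges form two such
families has no 3-matching, and a 2-matching takes one edge from each family. Stars and triangles are
the intersecting families that occur below.
\<close>
lemma matchings_two_intersecting:
  assumes E: "edges G = A \<union> B" and AB: "A \<inter> B = {}" "intersecting A" "intersecting B"
    and fin: "finite (edges G)" and two: "\<And>e. e \<in> edges G \<Longrightarrow> card e = 2"
  shows "num_matchings G 2 = card (disjoint_pairs A B)"
    and "3 \<le> j \<Longrightarrow> num_matchings G j = 0"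
proof -
  have finA: "finite (disjoint_pairs X Y)" if "finite X" "finite Y" for X Y :: "'a set set"
    by (rule finite_subset[of _ "X \<times> Y"]) (use that in \<open>auto simp: disjoint_pairs_def\<close>)
  have "disjoint_pairs (edges G) (edges G) = disjoint_pairs A B \<union> prod.swap ` disjoint_pairs A B"
    using AB(2,3) unfolding E by (auto simp: disjoint_pairs_def intersecting_def image_iff Int_commute)
  moreover have "disjoint_pairs A B \<inter> prod.swap ` disjoint_pairs A B = {}"
    using AB(1) by (auto simp: disjoint_pairs_def)
  moreover have "finite (disjoint_pairs A B)" using finA fin E by auto
  ultimately have "card (disjoint_pairs (edges G) (edges G)) =
      card (disjoint_pairs A B) + card (prod.swap ` disjoint_pairs A B)"
    by (simp add: card_Un_disjoint)
  also have "card (prod.swap ` disjoint_pairs A B) = card (disjoint_pairs A B)"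
    by (rule card_image) simp
  finally show "num_matchings G 2 = card (disjoint_pairs A B)"
    using twice_num_matchings_2[OF fin two] by simp
  show "num_matchings G j = 0" if "3 \<le> j"
  proof -
    have "False" if M: "M \<in> matchings G j" for M
    proof -
      have small: "card (M \<inter> X) \<le> 1" if "intersecting X" for X
      proof -
        have "finite (M \<inter> X)" using M finite_subset[OF _ fin] by (auto simp: matchings_def)
        moreover have "e = f" if "e \<in> M \<inter> X" "f \<in> M \<inter> X" for e f
        proof -
          have "e \<inter> f \<noteq> {}" using \<open>intersecting X\<close> that unfolding intersecting_def by blast
          moreover have "disjoint M" using M by (simp add: matchings_def)
          ultimately show ?thesis using that disjointD by blast
        qed
        ultimately show ?thesis by (simp add: card_le_Suc0_iff_eq)
      qed
      have "(M \<inter> A) \<union> (M \<inter> B) = M" using M E unfolding matchings_def by blast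
      then have "card M \<le> card (M \<inter> A) + card (M \<inter> B)"
        using card_Un_le[of "M \<inter> A" "M \<inter> B"] by simp
      then show False using small[OF AB(2)] small[OF AB(3)] M \<open>3 \<le> j\<close> by (simp add: matchings_def)
    qed
    then show ?thesis unfolding num_matchings_def by (metis card.empty equals0I)
  qed
qed

section \<open>Shapes of graphs without a 3-matching\<close>

definition two_cover :: "'a set set \<Rightarrow> bool" where
  "two_cover E \<longleftrightarrow> (\<exists>u v. \<forall>e\<in>E. u \<in> e \<or> v \<in> e)"

definition outer_neighbours :: "'a set set \<Rightarrow> 'a set \<Rightarrow> 'a \<Rightarrow> 'a set" where
  "outer_neighbours E W x = {y. {x, y} \<in> E} - W"

text \<open>
The obstructions to a 3-matching in the Tutte-Berge formula: removing r \<le> 2 vertices leaves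
components of odd order, and r plus the sum of their halved orders, rounded down, is 2.
\<close>
definition small_matching_shape :: "'a set set \<Rightarrow> bool" where
  "small_matching_shape E \<longleftrightarrow> two_cover E
    \<or> (\<exists>v T. card T = 3 \<and> v \<notin> T \<and> (\<forall>e\<in>E. v \<in> e \<or> e \<subseteq> T))
    \<or> (\<exists>S T. card S = 3 \<and> card T = 3 \<and> S \<inter> T = {} \<and> (\<forall>e\<in>E. e \<subseteq> S \<or> e \<subseteq> T))
    \<or> (\<exists>F. finite F \<and> card F \<le> 5 \<and> (\<forall>e\<in>E. e \<subseteq> F))"

context
  fixes E :: "'a set set"
  assumes two: "\<And>e. e \<in> E \<Longrightarrow> card e = 2"
    and no3: "\<And>e f g. \<lbrakk>e \<in> E; f \<in> E; g \<in> E; e \<inter> f = {}; e \<inter> g = {}; f \<inter> g = {}\<rbrakk> \<Longrightarrow> False"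
begin

text \<open>
No edge avoids both edges of the matching ab, cd, so each edge can be written with its end x
among a, b, c, d.
\<close>
lemma edge_near:
  assumes "{a, b} \<in> E" "{c, d} \<in> E" "distinct [a, b, c, d]" "e \<in> E"
  obtains x y where "e = {x, y}" "x \<noteq> y" "x \<in> {a, b, c, d}"
    "y \<in> {a, b, c, d} \<or> y \<in> outer_neighbours E {a, b, c, d} x"
proof -
  obtain x y where xy: "e = {x, y}" "x \<noteq> y" using two[OF assms(4)] by (metis card_2_iff)
  have "x \<in> {a, b, c, d} \<or> y \<in> {a, b, c, d}"
    using no3[OF assms(1,2,4)] assms(3) xy by auto
  then show ?thesis
    using that[of x y] that[of y x] xy assms(4) unfolding outer_neighbours_def by (auto simp: insert_commute)
qed

text \<open>
Distinct outer neighbours of a and b would turn the edge ab into two disjoint edges. Hence either one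
of a, b has no outer neighbour, or both have the same single one. The three following lemmas treat the
combinations of these two possibilities for the edges ab and cd.
\<close>
lemma outer_single:
  assumes "{a, b} \<in> E" "{c, d} \<in> E" "distinct [a, b, c, d]"
    "x \<in> outer_neighbours E {a, b, c, d} a" "y \<in> outer_neighbours E {a, b, c, d} b"
  shows "x = y"
  using no3[of "{a, x}" "{b, y}" "{c, d}"] assms by (auto simp: outer_neighbours_def)

text \<open>
Only the edge bd can avoid both a and c. If it is present, then a and c cannot have distinct outer
neighbours, as these would give a third disjoint edge.
\<close>
lemma shape_if_one_sided:
  assumes ab: "{a, b} \<in> E" and cd: "{c, d} \<in> E" and W: "distinct [a, b, c, d]"
    and b: "outer_neighbours E {a, b, c, d} b = {}" and d: "outer_neighbours E {a, b, c, d} d = {}"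
  shows "small_matching_shape E"
proof (cases "{b, d} \<in> E")
  case False
  have "a \<in> e \<or> c \<in> e" if "e \<in> E" for e
    using edge_near[OF ab cd W that]
    by (rule) (use b d False that in \<open>auto simp: insert_commute\<close>)
  then show ?thesis unfolding small_matching_shape_def two_cover_def by blast
next
  case bd: True
  let ?W = "{a, b, c, d}"
  have same: "x = y" if "x \<in> outer_neighbours E ?W a" "y \<in> outer_neighbours E ?W c" for x y
    using no3[of "{a, x}" "{c, y}" "{b, d}"] that W bd by (auto simp: outer_neighbours_def)
  consider "outer_neighbours E ?W a = {}" | "outer_neighbours E ?W c = {}"
    | x where "outer_neighbours E ?W a = {x}" "outer_neighbours E ?W c = {x}"
    using same by blast
  then show ?thesis
  proof cases
    case 1
    have "c \<in> e \<or> e \<subseteq> {a, b, d}" if "e \<in> E" for e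
      using edge_near[OF ab cd W that] by (rule) (use b d 1 in auto)
    then show ?thesis using W unfolding small_matching_shape_def
      by (intro disjI2 disjI1 exI[of _ c] exI[of _ "{a, b, d}"]) auto
  next
    case 2
    have "a \<in> e \<or> e \<subseteq> {b, c, d}" if "e \<in> E" for e
      using edge_near[OF ab cd W that] by (rule) (use b d 2 in auto)
    then show ?thesis using W unfolding small_matching_shape_def
      by (intro disjI2 disjI1 exI[of _ a] exI[of _ "{b, c, d}"]) auto
  next
    case 3
    have "e \<subseteq> {a, b, c, d, x}" if "e \<in> E" for e
      using edge_near[OF ab cd W that] by (rule) (use b d 3 in auto)
    then show ?thesis unfolding small_matching_shape_def
      by (intro disjI2 exI[of _ "{a, b, c, d, x}"]) (auto simp: card_insert_if)
  qed
qed

text \<open>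
If c has an outer neighbour y apart from x, then an edge from d to the triangle abx would be disjoint
from cy and from the opposite edge of the triangle; so all edges avoiding c lie in the triangle.
\<close>
lemma shape_if_one_common_neighbour:
  assumes ab: "{a, b} \<in> E" and cd: "{c, d} \<in> E" and W: "distinct [a, b, c, d]"
    and a: "outer_neighbours E {a, b, c, d} a = {x}" and b: "outer_neighbours E {a, b, c, d} b = {x}"
    and d: "outer_neighbours E {a, b, c, d} d = {}"
  shows "small_matching_shape E"
proof (cases "outer_neighbours E {a, b, c, d} c \<subseteq> {x}")
  case True
  have "e \<subseteq> {a, b, c, d, x}" if "e \<in> E" for e
    using edge_near[OF ab cd W that] by (rule) (use a b d True in auto)
  then show ?thesis unfolding small_matching_shape_def
    by (intro disjI2 exI[of _ "{a, b, c, d, x}"]) (auto simp: card_insert_if)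
next
  case False
  then obtain y where y: "{c, y} \<in> E" "y \<notin> {a, b, c, d}" "y \<noteq> x" by (auto simp: outer_neighbours_def)
  have x: "{a, x} \<in> E" "{b, x} \<in> E" "x \<notin> {a, b, c, d}" using a b by (auto simp: outer_neighbours_def)
  have "{a, d} \<notin> E" using no3[of "{a, d}" "{c, y}" "{b, x}"] x y W by auto
  moreover have "{b, d} \<notin> E" using no3[of "{b, d}" "{c, y}" "{a, x}"] x y W by auto
  ultimately have ad: "{a, d} \<notin> E" "{b, d} \<notin> E" by simp_all
  have "c \<in> e \<or> e \<subseteq> {a, b, x}" if "e \<in> E" for e
    using edge_near[OF ab cd W that] by (rule) (use a b d ad that in \<open>auto simp: insert_commute\<close>)
  then show ?thesis using W x unfolding small_matching_shape_def
    by (intro disjI2 disjI1 exI[of _ c] exI[of _ "{a, b, x}"]) auto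
qed

text \<open>
If x and y differ, then abx and cdy are triangles, and an edge between them would be disjoint from
an edge of each.
\<close>
lemma shape_if_two_common_neighbours:
  assumes ab: "{a, b} \<in> E" and cd: "{c, d} \<in> E" and W: "distinct [a, b, c, d]"
    and a: "outer_neighbours E {a, b, c, d} a = {x}" and b: "outer_neighbours E {a, b, c, d} b = {x}"
    and c: "outer_neighbours E {a, b, c, d} c = {y}" and d: "outer_neighbours E {a, b, c, d} d = {y}"
  shows "small_matching_shape E"
proof (cases "x = y")
  case True
  have "e \<subseteq> {a, b, c, d, x}" if "e \<in> E" for e
    using edge_near[OF ab cd W that] by (rule) (use a b c d True in auto)
  then show ?thesis unfolding small_matching_shape_def
    by (intro disjI2 exI[of _ "{a, b, c, d, x}"]) (auto simp: card_insert_if)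
next
  case False
  have xy: "{a, x} \<in> E" "{b, x} \<in> E" "x \<notin> {a, b, c, d}" "{c, y} \<in> E" "{d, y} \<in> E" "y \<notin> {a, b, c, d}"
    using a b c d by (auto simp: outer_neighbours_def)
  have cross: "{p, q} \<notin> E" if "p \<in> {a, b}" "q \<in> {c, d}" for p q
    using no3[of "{p, q}" "{if p = a then b else a, x}" "{if q = c then d else c, y}"] that xy False W
    by auto
  have "{a, c} \<notin> E" "{a, d} \<notin> E" "{b, c} \<notin> E" "{b, d} \<notin> E" using cross by auto
  then have "e \<subseteq> {a, b, x} \<or> e \<subseteq> {c, d, y}" if "e \<in> E" for e
    by (rule_tac edge_near[OF ab cd W that]) (use a b c d that in \<open>auto simp: insert_commute\<close>)
  then show ?thesis using W xy False unfolding small_matching_shape_def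
    by (intro disjI2 disjI1 exI[of _ "{a, b, x}"] exI[of _ "{c, d, y}"]) auto
qed

text \<open>
If any two edges meet, the two ends of one edge cover everything. Otherwise the lemmas above apply to a
2-matching, after exchanging its edges or the ends of an edge.
\<close>
lemma shape_if_no_three_disjoint_edges: "small_matching_shape E"
proof (cases "\<exists>e\<in>E. \<exists>f\<in>E. e \<inter> f = {}")
  case False
  have "two_cover E"
  proof (cases "E = {}")
    case False
    then obtain e where e: "e \<in> E" by blast
    then obtain u v where uv: "e = {u, v}" using two by (metis card_2_iff)
    have "u \<in> f \<or> v \<in> f" if "f \<in> E" for f
    proof -
      have "e \<inter> f \<noteq> {}" using \<open>\<not> (\<exists>e\<in>E. \<exists>f\<in>E. e \<inter> f = {})\<close> e that by blast
      then show ?thesis using uv by auto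
    qed
    then show ?thesis unfolding two_cover_def by blast
  qed (simp add: two_cover_def)
  then show ?thesis by (simp add: small_matching_shape_def)
next
  case True
  then obtain e f where ef: "e \<in> E" "f \<in> E" "e \<inter> f = {}" by blast
  obtain a b c d where abcd: "e = {a, b}" "a \<noteq> b" "f = {c, d}" "c \<noteq> d"
    using two ef by (metis card_2_iff)
  let ?o = "outer_neighbours E {a, b, c, d}"
  have ab: "{a, b} \<in> E" and cd: "{c, d} \<in> E" and W: "distinct [a, b, c, d]" using ef abcd by auto
  have sets: "{b, a, c, d} = {a, b, c, d}" "{a, b, d, c} = {a, b, c, d}" "{b, a, d, c} = {a, b, c, d}"
    "{c, d, a, b} = {a, b, c, d}" "{c, d, b, a} = {a, b, c, d}"
    by auto
  have sym: "{b, a} \<in> E" "{d, c} \<in> E" "distinct [b, a, c, d]" "distinct [a, b, d, c]"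
    "distinct [b, a, d, c]" "distinct [c, d, a, b]" "distinct [c, d, b, a]"
    using ab cd W by (auto simp: insert_commute)
  have split: "?o a = {} \<or> ?o b = {} \<or> (\<exists>x. ?o a = {x} \<and> ?o b = {x})"
    using outer_single[OF ab cd W] by blast
  have split': "?o c = {} \<or> ?o d = {} \<or> (\<exists>x. ?o c = {x} \<and> ?o d = {x})"
    using outer_single[OF cd ab sym(6), unfolded sets] by blast
  show ?thesis
    using split split'
      shape_if_one_sided[OF ab cd W] shape_if_one_sided[OF sym(1) cd sym(3), unfolded sets]
      shape_if_one_sided[OF ab sym(2) sym(4), unfolded sets]
      shape_if_one_sided[OF sym(1) sym(2) sym(5), unfolded sets]
      shape_if_one_common_neighbour[OF ab cd W] shape_if_one_common_neighbour[OF ab sym(2) sym(4), unfolded sets]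
      shape_if_one_common_neighbour[OF cd ab sym(6), unfolded sets]
      shape_if_one_common_neighbour[OF cd sym(1) sym(7), unfolded sets]
      shape_if_two_common_neighbours[OF ab cd W]
    by blast
qed
end

section \<open>Two stars, a star with a triangle, two triangles\<close>

definition star :: "'a \<Rightarrow> 'a set \<Rightarrow> 'a set set" where
  "star v P = (\<lambda>x. {v, x}) ` P"

definition triangle :: "'a set \<Rightarrow> 'a set set" where
  "triangle T = {e. e \<subseteq> T \<and> card e = 2}"

lemma inj_on_doubleton: "inj_on (\<lambda>x. {v, x}) P"
  by (auto simp: inj_on_def doubleton_eq_iff)

lemma card_star: "card (star v P) = card P"
  by (simp add: star_def card_image inj_on_doubleton)

lemma doubleton_in_star_iff: "{x, y} \<in> star v P \<longleftrightarrow> (x = v \<and> y \<in> P) \<or> (y = v \<and> x \<in> P)"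
  by (auto simp: star_def doubleton_eq_iff)

lemma intersecting_star: "intersecting (star v P)"
  by (auto simp: intersecting_def star_def)

lemma triangle_insert:
  assumes "a \<noteq> b" "a \<noteq> c" "b \<noteq> c"
  shows "triangle {a, b, c} = {{a, b}, {a, c}, {b, c}}"
proof -
  have "e \<in> {{a, b}, {a, c}, {b, c}}" if "e \<subseteq> {a, b, c}" "card e = 2" for e
  proof -
    obtain x y where "e = {x, y}" "x \<noteq> y" using \<open>card e = 2\<close> by (metis card_2_iff)
    then show ?thesis using \<open>e \<subseteq> {a, b, c}\<close> by (auto simp: insert_commute)
  qed
  then show ?thesis using assms by (auto simp: triangle_def)
qed

lemma card_triangle: "card T = 3 \<Longrightarrow> card (triangle T) = 3"
proof -
  assume "card T = 3"
  then obtain a b c where "T = {a, b, c}" "a \<noteq> b" "a \<noteq> c" "b \<noteq> c" by (metis card_3_iff)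
  then show ?thesis by (simp add: triangle_insert doubleton_eq_iff card_insert_if)
qed

lemma intersecting_triangle: "card T = 3 \<Longrightarrow> intersecting (triangle T)"
proof -
  assume "card T = 3"
  then obtain a b c where "T = {a, b, c}" "a \<noteq> b" "a \<noteq> c" "b \<noteq> c" by (metis card_3_iff)
  then show ?thesis by (simp add: triangle_insert intersecting_def)
qed

text \<open>
The vertex v may be a leaf of the star at u: the edge uv then meets every edge of the star at v, which
is why only P - {v} enters the product.
\<close>
lemma matchings_two_stars:
  assumes E: "edges G = star u P \<union> star v Q" and uv: "u \<noteq> v" "u \<notin> P" "u \<notin> Q" "v \<notin> Q"
    and fin: "finite P" "finite Q"
  shows "card (edges G) = card P + card Q"
    and "num_matchings G 2 + card (P \<inter> Q) = card (P - {v}) * card Q"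
    and "3 \<le> j \<Longrightarrow> num_matchings G j = 0"
proof -
  have disj: "star u P \<inter> star v Q = {}"
    using uv by (auto simp: star_def doubleton_eq_iff)
  have finE: "finite (edges G)" using fin by (simp add: E star_def)
  have two: "card e = 2" if "e \<in> edges G" for e
    using that uv unfolding E star_def by (auto simp: card_insert_if)
  note count = matchings_two_intersecting[OF E disj intersecting_star intersecting_star finE two]
  show "card (edges G) = card P + card Q"
    using fin disj by (simp add: E card_Un_disjoint card_star star_def[of u P] star_def[of v Q])
      (simp add: card_star flip: star_def)
  show "num_matchings G j = 0" if "3 \<le> j" using count(2) that by blast
  let ?D = "(P - {v}) \<times> Q - (\<lambda>x. (x, x)) ` (P \<inter> Q)"
  have "disjoint_pairs (star u P) (star v Q) = (\<lambda>(x, y). ({u, x}, {v, y})) ` ?D"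
    using uv by (auto simp: disjoint_pairs_def star_def)
  moreover have "inj_on (\<lambda>(x, y). ({u, x}, {v, y})) ?D"
    by (auto simp: inj_on_def doubleton_eq_iff)
  ultimately have "num_matchings G 2 = card ?D"
    using count(1) by (simp add: card_image)
  also have "card ?D + card (P \<inter> Q) = card ((P - {v}) \<times> Q)"
  proof -
    have sub: "(\<lambda>x. (x, x)) ` (P \<inter> Q) \<subseteq> (P - {v}) \<times> Q" using uv by auto
    moreover have "card ((\<lambda>x. (x, x)) ` (P \<inter> Q)) = card (P \<inter> Q)"
      by (simp add: card_image inj_on_def)
    ultimately show ?thesis
      using card_Diff_subset[of "(\<lambda>x. (x, x)) ` (P \<inter> Q)" "(P - {v}) \<times> Q"]
        card_mono[OF _ sub] fin by simp
  qed
  finally show "num_matchings G 2 + card (P \<inter> Q) = card (P - {v}) * card Q"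
    by (simp add: card_cartesian_product)
qed

text \<open>
An edge vx is disjoint from all three edges of the triangle if x lies outside T, and from just one of
them if x lies in T.
\<close>
lemma matchings_star_triangle:
  assumes E: "edges G = star v P \<union> triangle T" and T: "card T = 3" and v: "v \<notin> T" "v \<notin> P"
    and fin: "finite P"
  shows "card (edges G) = card P + 3"
    and "num_matchings G 2 + 2 * card (P \<inter> T) = 3 * card P"
    and "3 \<le> j \<Longrightarrow> num_matchings G j = 0"
proof -
  have disj: "star v P \<inter> triangle T = {}"
    using v by (auto simp: star_def triangle_def)
  have finT: "finite (triangle T)" using card_triangle[OF T] card_ge_0_finite by force
  have finS: "finite (star v P)" using fin by (simp add: star_def)
  have finE: "finite (edges G)" using finS finT by (simp add: E)
  have two: "card e = 2" if "e \<in> edges G" for e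
    using that v unfolding E star_def triangle_def by (auto simp: card_insert_if)
  note count = matchings_two_intersecting[OF E disj intersecting_star intersecting_triangle[OF T] finE two]
  show "card (edges G) = card P + 3"
    using finS finT disj card_triangle[OF T] by (simp add: E card_Un_disjoint card_star)
  show "num_matchings G j = 0" if "3 \<le> j" using count(2) that by blast
  have away: "card {e \<in> triangle T. x \<notin> e} = (if x \<in> T then 1 else 3)" for x
  proof -
    obtain a b c where T: "T = {a, b, c}" "a \<noteq> b" "a \<noteq> c" "b \<noteq> c" using T by (metis card_3_iff)
    have "{e \<in> triangle T. x \<notin> e} =
      (if x = a then {{b, c}} else if x = b then {{a, c}} else if x = c then {{a, b}} else triangle T)"
      using T by (auto simp: triangle_insert)
    then show ?thesis using T card_triangle[of T] by simp
  qed
  have "disjoint_pairs (star v P) (triangle T) =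
      (\<lambda>(x, e). ({v, x}, e)) ` (SIGMA x:P. {e \<in> triangle T. x \<notin> e})"
    using v by (fastforce simp: disjoint_pairs_def star_def triangle_def)
  moreover have "inj_on (\<lambda>(x, e). ({v, x}, e)) (SIGMA x:P. {e \<in> triangle T. x \<notin> e})"
    by (auto simp: inj_on_def doubleton_eq_iff)
  ultimately have "num_matchings G 2 = (\<Sum>x\<in>P. if x \<in> T then 1 else 3)"
    using count(1) fin finT by (simp add: card_image away)
  moreover have "(\<Sum>x\<in>P. if x \<in> T then 1 else 3) + 2 * card (P \<inter> T) = 3 * card P"
  proof -
    have "card P = card (P \<inter> T) + card (P - T)"
      using fin by (metis card_Int_Diff)
    then show ?thesis using fin by (simp add: sum.If_cases Diff_eq)
  qed
  ultimately show "num_matchings G 2 + 2 * card (P \<inter> T) = 3 * card P" by simp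
qed

lemma matchings_two_triangles:
  assumes E: "edges G = triangle S \<union> triangle T" and ST: "card S = 3" "card T = 3" "S \<inter> T = {}"
  shows "card (edges G) = 6" and "num_matchings G 2 = 9"
proof -
  have sep: "e \<inter> f = {}" if "e \<in> triangle S" "f \<in> triangle T" for e f
    using that ST(3) by (auto simp: triangle_def)
  have ne: "e \<noteq> {}" if "e \<in> triangle S" for e using that by (auto simp: triangle_def)
  have disj: "triangle S \<inter> triangle T = {}" using sep ne by blast
  have fin: "finite (triangle S)" "finite (triangle T)"
    using ST card_triangle card_ge_0_finite by (metis zero_less_numeral)+
  have finE: "finite (edges G)" and two: "\<And>e. e \<in> edges G \<Longrightarrow> card e = 2"
    using fin by (auto simp: E triangle_def)
  show "card (edges G) = 6" using fin disj ST by (simp add: E card_Un_disjoint card_triangle)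
  have "disjoint_pairs (triangle S) (triangle T) = triangle S \<times> triangle T"
    using sep by (auto simp: disjoint_pairs_def)
  then show "num_matchings G 2 = 9"
    using matchings_two_intersecting(1)[OF E disj intersecting_triangle[OF ST(1)]
        intersecting_triangle[OF ST(2)] finE two] ST
    by (simp add: card_cartesian_product card_triangle)
qed

section \<open>The graphs K(k, t; l)\<close>

text \<open>
The sets P \<inter> Q, P - Q and Q - P, together with the two centers, partition the vertices, and adjacency
depends only on the parts. So bijections between corresponding parts can be glued.
\<close>
lemma isomorphic_two_stars:
  assumes V: "verts G = {u, v} \<union> P \<union> Q" "verts H = {u', v'} \<union> P' \<union> Q'"
    and E: "edges G = star u P \<union> star v Q" "edges H = star u' P' \<union> star v' Q'"
    and G: "u \<noteq> v" "u \<notin> P \<union> Q" "v \<notin> P \<union> Q" "finite P" "finite Q"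
    and H: "u' \<noteq> v'" "u' \<notin> P' \<union> Q'" "v' \<notin> P' \<union> Q'" "finite P'" "finite Q'"
    and eq: "card P = card P'" "card Q = card Q'" "card (P \<inter> Q) = card (P' \<inter> Q')"
  shows "isomorphic G H"
proof -
  have PQ: "card (P - Q) = card (P' - Q')"
    using card_Int_Diff[OF G(4), of Q] card_Int_Diff[OF H(4), of Q'] eq by linarith
  have QP: "card (Q - P) = card (Q' - P')"
    using card_Int_Diff[OF G(5), of P] card_Int_Diff[OF H(5), of P'] eq
    by (simp add: Int_commute)
  obtain f1 where f1: "bij_betw f1 (P \<inter> Q) (P' \<inter> Q')"
    using finite_same_card_bij[of "P \<inter> Q" "P' \<inter> Q'"] eq G H by auto
  obtain f2 where f2: "bij_betw f2 (P - Q) (P' - Q')"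
    using finite_same_card_bij[of "P - Q" "P' - Q'"] PQ G H by auto
  obtain f3 where f3: "bij_betw f3 (Q - P) (Q' - P')"
    using finite_same_card_bij[of "Q - P" "Q' - P'"] QP G H by auto
  define f where "f x = (if x = u then u' else if x = v then v' else
      if x \<in> P \<inter> Q then f1 x else if x \<in> P then f2 x else f3 x)" for x
  have "bij_betw f (P \<inter> Q) (P' \<inter> Q')"
    using f1 by (rule bij_betw_cong[THEN iffD1, rotated]) (use G in \<open>auto simp: f_def\<close>)
  moreover have "bij_betw f (P - Q) (P' - Q')"
    using f2 by (rule bij_betw_cong[THEN iffD1, rotated]) (use G in \<open>auto simp: f_def\<close>)
  moreover have "bij_betw f (Q - P) (Q' - P')"
    using f3 by (rule bij_betw_cong[THEN iffD1, rotated]) (use G in \<open>auto simp: f_def\<close>)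
  moreover have "bij_betw f {u} {u'}" "bij_betw f {v} {v'}"
    using G by (auto simp: bij_betw_def f_def)
  ultimately have "bij_betw f ({u} \<union> ({v} \<union> (P \<inter> Q \<union> ((P - Q) \<union> (Q - P)))))
      ({u'} \<union> ({v'} \<union> (P' \<inter> Q' \<union> ((P' - Q') \<union> (Q' - P')))))"
    by (intro bij_betw_combine) (use H in auto)
  also have "{u} \<union> ({v} \<union> (P \<inter> Q \<union> ((P - Q) \<union> (Q - P)))) = verts G" using V by auto
  also have "{u'} \<union> ({v'} \<union> (P' \<inter> Q' \<union> ((P' - Q') \<union> (Q' - P')))) = verts H" using V by auto
  finally have bij: "bij_betw f (verts G) (verts H)" .
  have uf: "f x = u' \<longleftrightarrow> x = u" and vf: "f x = v' \<longleftrightarrow> x = v"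
    and Pf: "f x \<in> P' \<longleftrightarrow> x \<in> P" and Qf: "f x \<in> Q' \<longleftrightarrow> x \<in> Q" if "x \<in> verts G" for x
  proof -
    have "x = u \<or> x = v \<or> x \<in> P \<inter> Q \<or> x \<in> P - Q \<or> x \<in> Q - P" using that V by auto
    moreover have "f1 x \<in> P' \<inter> Q'" if "x \<in> P \<inter> Q" using bij_betwE[OF f1] that by blast
    moreover have "f2 x \<in> P' - Q'" if "x \<in> P - Q" using bij_betwE[OF f2] that by blast
    moreover have "f3 x \<in> Q' - P'" if "x \<in> Q - P" using bij_betwE[OF f3] that by blast
    ultimately show "f x = u' \<longleftrightarrow> x = u" "f x = v' \<longleftrightarrow> x = v"
        "f x \<in> P' \<longleftrightarrow> x \<in> P" "f x \<in> Q' \<longleftrightarrow> x \<in> Q"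
      using G H by (auto simp: f_def)
  qed
  show ?thesis
    unfolding isomorphic_def E Un_iff doubleton_in_star_iff
    using bij by (intro exI[of _ f]) (simp add: uf vf Pf Qf)
qed

lemma K_graph_two_stars:
  "edges (K_graph k t l) =
    star Center (Leaf ` {1..k}) \<union> star Hub (Pendant ` {1..t} \<union> Leaf ` {1..l})"
  by (auto simp: K_graph_def star_def)

lemma card_K_graph_leaves:
  assumes "l \<le> k"
  shows "card (Leaf ` {1..k}) = k"
    and "card (Pendant ` {1..t} \<union> Leaf ` {1..l}) = t + l"
    and "card (Leaf ` {1..k} \<inter> (Pendant ` {1..t} \<union> Leaf ` {1..l})) = l"
proof -
  show leaf: "card (Leaf ` {1..k}) = k" for k by (simp add: card_image inj_on_def)
  show "card (Pendant ` {1..t} \<union> Leaf ` {1..l}) = t + l"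
    by (subst card_Un_disjoint) (auto simp: card_image inj_on_def)
  have "Leaf ` {1..k} \<inter> (Pendant ` {1..t} \<union> Leaf ` {1..l}) = Leaf ` {1..l}" using assms by auto
  then show "card (Leaf ` {1..k} \<inter> (Pendant ` {1..t} \<union> Leaf ` {1..l})) = l" using leaf by simp
qed

lemma K_graph_counts:
  assumes "l \<le> k"
  shows "card (verts (K_graph k t l)) = k + t + 2"
    and "card (edges (K_graph k t l)) = k + t + l"
    and "num_matchings (K_graph k t l) 2 + l = k * (l + t)"
    and "3 \<le> j \<Longrightarrow> num_matchings (K_graph k t l) j = 0"
proof -
  have "verts (K_graph k t l) = insert Center (insert Hub (Leaf ` {1..k} \<union> Pendant ` {1..t}))"
    by (auto simp: K_graph_def)
  moreover have "card (Leaf ` {1..k} \<union> Pendant ` {1..t}) = k + t"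
    by (subst card_Un_disjoint) (auto simp: card_image inj_on_def)
  ultimately show "card (verts (K_graph k t l)) = k + t + 2"
    by (subst \<open>verts _ = _\<close>) (simp add: card_insert_if image_iff)
  have "Center \<noteq> Hub" "Center \<notin> Leaf ` {1..k}"
    "Center \<notin> Pendant ` {1..t} \<union> Leaf ` {1..l}" "Hub \<notin> Pendant ` {1..t} \<union> Leaf ` {1..l}"
    "finite (Leaf ` {1..k})" "finite (Pendant ` {1..t} \<union> Leaf ` {1..l})"
    by auto
  note count = matchings_two_stars[OF K_graph_two_stars this]
  show "card (edges (K_graph k t l)) = k + t + l"
    using count(1) card_K_graph_leaves[OF assms] by simp
  have "Leaf ` {1..k} - {Hub} = Leaf ` {1..k}" by auto
  then show "num_matchings (K_graph k t l) 2 + l = k * (l + t)"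
    using count(2) card_K_graph_leaves[OF assms] by (simp add: add.commute)
  show "3 \<le> j \<Longrightarrow> num_matchings (K_graph k t l) j = 0"
    by (rule count(3))
qed

section \<open>The exceptional triples and the arithmetic behind them\<close>

definition exceptional :: "nat \<Rightarrow> nat \<Rightarrow> nat \<Rightarrow> bool" where
  "exceptional k t l \<longleftrightarrow> (k, t, l) \<in> {(2, 1, 1), (2, 1, 2), (2, 2, 1), (3, 0, 2), (3, 1, 1), (3, 1, 2),
                  (3, 2, 2), (3, 0, 3), (4, 1, 2), (4, 3, 1)}"

text \<open>
With p + q = k + b the product (p - k) (p - b) equals k b - p q \<le> 0, so p lies between
the numbers k and b, which are at most one apart.
\<close>
lemma balanced_product:
  fixes p q k b :: nat
  assumes "p + q = k + b" "k * b \<le> p * q" "\<bar>int b - int k\<bar> \<le> 1"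
  shows "p = k \<and> q = b \<or> p = b \<and> q = k"
proof -
  have "(int p - int k) * (int p - int b) = int (k * b) - int (p * q)"
  proof -
    have "int q = int k + int b - int p" using assms(1) by linarith
    then have "int p * int q = int p * (int k + int b - int p)" by simp
    then show ?thesis by (simp add: algebra_simps)
  qed
  then have neg: "\<not> (int p - int k) * (int p - int b) > 0" using assms(2) by linarith
  have "\<not> (int p < int k \<and> int p < int b)"
    using neg mult_neg_neg[of "int p - int k" "int p - int b"] by linarith
  moreover have "\<not> (int p > int k \<and> int p > int b)"
    using neg mult_pos_pos[of "int p - int k" "int p - int b"] by linarith
  ultimately show ?thesis using assms(1,3) by linarith
qed

text \<open>
By the inequality of the means, 4 (k b - 1) \<le> 4 p q \<le> (k + b - 1)^2. For balanced k and b the left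
side is at least (k + b)^2 - 5, which forces k + b \<le> 3.
\<close>
lemma adjacent_cover_small:
  fixes p q k b c l :: nat
  assumes sum: "p + q + 1 = k + b" and prod: "p * q + l = k * b + c" and c: "l \<le> c + 1"
    and l: "1 \<le> l" "l \<le> k" "l \<le> b" and bal: "\<bar>int b - int k\<bar> \<le> 1"
  shows "p \<le> 1 \<and> q \<le> 1 \<and> p + q \<ge> 1 \<and> c = 0"
proof -
  have "4 * (int p * int q) \<le> (int p + int q)\<^sup>2"
    using zero_le_power2[of "int p - int q"] by (simp add: power2_eq_square algebra_simps)
  moreover have "int p + int q = int k + int b - 1" using sum by linarith
  moreover have "int k * int b \<le> int p * int q + 1"
    using prod c by (metis (no_types) add_le_cancel_right add.assoc add.commute of_nat_1 of_nat_add
        of_nat_le_iff of_nat_mult nat_add_left_cancel_le)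
  ultimately have main: "4 * (int k * int b) \<le> (int k + int b - 1)\<^sup>2 + 4" by simp
  consider "b = k" | "b = k + 1" | "k = b + 1" using bal by linarith
  then have "(k, b) \<in> {(1, 1), (1, 2), (2, 1)}"
  proof cases
    case 1
    then have "4 * int k \<le> 5" using main by (simp add: power2_eq_square algebra_simps)
    then show ?thesis using 1 l by auto
  next
    case 2
    then have "4 * int k \<le> 4" using main by (simp add: power2_eq_square algebra_simps)
    then show ?thesis using 2 l by auto
  next
    case 3
    then have "4 * int b \<le> 4" using main by (simp add: power2_eq_square algebra_simps)
    then show ?thesis using 3 l by auto
  qed
  moreover from this have "p \<in> {0, 1, 2}" using sum by auto
  ultimately show ?thesis using sum prod l by auto
qed

text \<open>
The equations say (k - 3) (b - 3) = l - 2 s for b = l + t. The right side is at most 1 - s \<le> 1,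
and k - 3 and b - 3 differ by at most one, so both lie in {-1, 0, 1}. Product 1 forces s = 0 and l = 1;
product 0 forces l = 2 s with s \<le> 1, that is s = 1 and l = 2.
\<close>
lemma star_triangle_arithmetic:
  fixes k t l d s :: nat
  assumes "k + t + l = d + 3" "k * (l + t) + 2 * s = 3 * d + l" "l \<le> s + 1"
    and "1 \<le> l" "l \<le> k" "\<bar>int l + int t - int k\<bar> \<le> 1"
  shows "exceptional k t l"
proof -
  define x y where "x = int k - 3" and "y = int (l + t) - 3"
  have k: "int k = x + 3" and b: "int l + int t = y + 3" by (simp_all add: x_def y_def)
  have "int k * (int l + int t) + 2 * int s = 3 * (int k + int t + int l - 3) + int l"
    using assms(1) arg_cong[OF assms(2), of int] by simp
  then have xy: "x * y = int l - 2 * int s"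
    unfolding k b using b by (simp add: k algebra_simps)
  have bal: "y \<in> {x - 1, x, x + 1}" using assms(6) k b by auto
  have "x * y \<le> 1" using xy assms(3) by linarith
  moreover have "x * y \<ge> 2" if "x \<ge> 2" using that bal mult_mono[of 2 x 1 y] by auto
  moreover have "x * y \<ge> 2" if "x \<le> - 2"
    using that bal mult_mono[of 2 "- x" 1 "- y"] by auto
  ultimately have "-2 < x \<and> x < 2" by linarith
  then have "x = -1 \<or> x = 0 \<or> x = 1" by linarith
  then have pairs: "(x, y) \<in> {(-1, -1), (-1, 0), (0, -1), (0, 0), (0, 1), (1, 0), (1, 1)}"
    using bal \<open>x * y \<le> 1\<close> by auto
  then have "x * y = 0 \<or> x * y = 1" by auto
  moreover have "l = 1" if "x * y = 1"
    using xy assms(3,4) unfolding that by linarith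
  moreover have "l = 2" if "x * y = 0"
    using xy assms(3,4) unfolding that by presburger
  ultimately have "x * y = 1 \<and> l = 1 \<or> x * y = 0 \<and> l = 2" by blast
  moreover have "k = nat (x + 3)" "t = nat (y + 3) - l" using k b by linarith+
  ultimately show ?thesis
    using pairs unfolding exceptional_def by (elim insertE emptyE) auto
qed

text \<open>
The bound in \<open>deg\<close> is the one of \<open>five_vertices_bounds\<close> below; it is sharp if there are five
vertices, all of degree c or c + 1. Here c = 2 handles all cases except k = b = l = 5, where c = 3 is needed.
\<close>
lemma five_vertices_arithmetic:
  fixes k t l :: nat
  assumes "1 \<le> l" "l \<le> k" "\<bar>int l + int t - int k\<bar> \<le> 1" "k + t + l \<le> 10"
    and deg: "\<And>c. 2 * m2 + (2 * c + 1) * (2 * (k + t + l)) \<le> (k + t + l)\<^sup>2 + (k + t + l) + 5 * (c * (c + 1))"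
    and m2: "m2 + l = k * (l + t)" and n: "k + t + 2 \<ge> 5 \<or> k + t + l \<ge> 6"
  shows "exceptional k t l"
proof -
  define b where "b = l + t"
  have t: "t = b - l" "l \<le> b" by (auto simp: b_def)
  have m: "k + t + l = k + b" by (simp add: b_def)
  have e: "2 * (k * b) + (2 * c + 1) * (2 * (k + b)) \<le> (k + b)\<^sup>2 + (k + b) + 5 * (c * (c + 1)) + 2 * l" for c
    using deg[of c] m2 unfolding m b_def[symmetric] by linarith
  have "b = k \<or> b = k + 1 \<or> k = b + 1" using assms(3) b_def by linarith
  moreover have "1 \<le> b" "1 \<le> k" "k + b \<le> 10" using assms(1,2,4) b_def by linarith+
  ultimately have "k \<in> {1, 2, 3, 4, 5}" "b = k \<or> b = k + 1 \<or> k = b + 1" by auto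
  then have kb: "(k, b) \<in> {(1, 1), (1, 2), (2, 1), (2, 2), (2, 3), (3, 2), (3, 3), (3, 4),
      (4, 3), (4, 4), (4, 5), (5, 4), (5, 5)}"
    using \<open>1 \<le> b\<close> \<open>k + b \<le> 10\<close> by (elim insertE emptyE) auto
  \<comment> \<open>The order k + t + 2 in terms of k, b and l, which are bounded now.\<close>
  have n': "5 \<le> k + b + 2 - l \<or> 6 \<le> k + b" using n b_def by linarith
  have "l \<in> {1, 2, 3, 4, 5}" using \<open>k \<in> {1, 2, 3, 4, 5}\<close> assms(1,2) by auto
  with kb show ?thesis
    using e[of 2] e[of 3] n' \<open>l \<le> k\<close> \<open>l \<le> b\<close> unfolding exceptional_def t(1)
    by (elim insertE emptyE) (simp_all add: power2_eq_square)
qed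

section \<open>Graphs on few vertices\<close>

text \<open>
An integer d satisfies (d - c) (d - c - 1) \<ge> 0, so the sum of the squared degrees over at most five
vertices is at least (2 c + 1) times the degree sum minus 5 c (c + 1). The quadratic degree
identity turns this into a bound on the number of 2-matchings.
\<close>
lemma five_vertices_bounds:
  assumes F: "finite F" "card F \<le> 5" "\<And>e. e \<in> edges G \<Longrightarrow> e \<subseteq> F \<and> card e = 2"
  shows "card (edges G) \<le> 10"
    and "2 * num_matchings G 2 + (2 * c + 1) * (2 * card (edges G))
      \<le> (card (edges G))\<^sup>2 + card (edges G) + 5 * (c * (c + 1))"
proof -
  have "card (edges G) \<le> card {e. e \<subseteq> F \<and> card e = 2}"
    by (rule card_mono) (use F in auto)
  also have "\<dots> = card F choose 2" by (rule n_subsets[OF F(1)])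
  also have "\<dots> \<le> 5 choose 2" using F(2) by (simp add: binomial_right_mono)
  finally show "card (edges G) \<le> 10" by (simp add: choose_two)
  define d where "d x = card {e \<in> edges G. x \<in> e}" for x
  have "(2 * c + 1) * d x \<le> (d x)\<^sup>2 + c * (c + 1)" for x
  proof -
    have "(int (d x) - int c) * (int (d x) - int c - 1) \<ge> 0"
      by (cases "int (d x) \<le> int c") (simp_all add: mult_nonpos_nonpos)
    then have "int ((2 * c + 1) * d x) \<le> int ((d x)\<^sup>2 + c * (c + 1))"
      by (simp add: power2_eq_square algebra_simps)
    then show ?thesis by linarith
  qed
  then have "(\<Sum>x\<in>F. (2 * c + 1) * d x) \<le> (\<Sum>x\<in>F. (d x)\<^sup>2 + c * (c + 1))"
    by (intro sum_mono)
  also have "\<dots> = (\<Sum>x\<in>F. (d x)\<^sup>2) + card F * (c * (c + 1))"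
    by (simp add: sum.distrib)
  finally have "(2 * c + 1) * (\<Sum>x\<in>F. d x) \<le> (\<Sum>x\<in>F. (d x)\<^sup>2) + 5 * (c * (c + 1))"
    using mult_le_mono1[OF F(2), of "c * (c + 1)"] by (simp only: sum_distrib_left)
  then show "2 * num_matchings G 2 + (2 * c + 1) * (2 * card (edges G))
      \<le> (card (edges G))\<^sup>2 + card (edges G) + 5 * (c * (c + 1))"
    using degree_sums[of F G, OF F(1) F(3)] by (simp add: d_def)
qed

lemma subset_doubleton:
  assumes "finite A" "card A \<le> 2"
  obtains u v where "A \<subseteq> {u, v}"
proof -
  consider "card A = 0" | "card A = Suc 0" | "card A = 2" using assms(2) by linarith
  then show ?thesis
    by cases (use assms(1) that in \<open>auto simp: card_1_singleton_iff card_2_iff\<close>)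
qed

text \<open>
On four vertices, fewer than six edges leave some pair x, y nonadjacent; on fewer vertices x = y is taken.
Either way at most two vertices lie outside {x, y}, and they meet every edge.
\<close>
lemma two_cover_four_vertices:
  assumes V: "finite V" "card V \<le> 4" and E: "\<And>e. e \<in> E \<Longrightarrow> e \<subseteq> V \<and> card e = 2"
    and few: "card E < 6"
  shows "two_cover E"
proof -
  obtain x y where xy: "{x, y} \<notin> E" "card (V - {x, y}) \<le> 2"
  proof (cases "card V = 4")
    case True
    have "card {e. e \<subseteq> V \<and> card e = 2} = 6"
      using n_subsets[OF V(1), of 2] True by (simp add: choose_two)
    then have "E \<noteq> {e. e \<subseteq> V \<and> card e = 2}" using few by auto
    then obtain x y where "{x, y} \<notin> E" "x \<noteq> y" "x \<in> V" "y \<in> V"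
      using E by (auto simp: card_2_iff)
    then show ?thesis using that True V by (simp add: card_Diff_subset)
  next
    case False
    \<comment> \<open>arbitrary if V is empty\<close>
    define w where "w = (SOME w. w \<in> V)"
    have "card (V - {w}) \<le> 2"
    proof (cases "V = {}")
      case nonempty: False
      then have "w \<in> V" by (simp add: w_def some_in_eq)
      then show ?thesis using False V by simp
    qed simp
    then show ?thesis using that[of w w] E[of "{w}"] by auto
  qed
  obtain u v where uv: "V - {x, y} \<subseteq> {u, v}"
    using subset_doubleton[OF _ xy(2)] V(1) by blast
  have "u \<in> e \<or> v \<in> e" if "e \<in> E" for e
  proof (rule ccontr)
    assume "\<not> (u \<in> e \<or> v \<in> e)"
    then have "e \<subseteq> {x, y}" using E[OF that] uv by blast
    moreover have "card {x, y} \<le> card e" using E[OF that] by (simp add: card_insert_if)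
    ultimately have "e = {x, y}" using card_seteq[of "{x, y}" e] by simp
    then show False using xy that by simp
  qed
  then show ?thesis unfolding two_cover_def by blast
qed

section \<open>Graphs with the matching numbers of K(k, t; l)\<close>

text \<open>
If one edge of a triangle is missing, the opposite vertex meets the other two edges.
\<close>
lemma triangle_avoiding_edge:
  assumes "card T = 3" "f \<in> triangle T"
  obtains w where "w \<in> T" "\<And>e. e \<subseteq> T \<Longrightarrow> card e = 2 \<Longrightarrow> e \<noteq> f \<Longrightarrow> w \<in> e"
proof -
  have fT: "f \<subseteq> T" "card f = 2" using assms(2) by (auto simp: triangle_def)
  have finT: "finite T" using assms(1) card_ge_0_finite by force
  then have finf: "finite f" using fT finite_subset by blast
  have "card (T - f) = 1" using fT assms(1) finf by (simp add: card_Diff_subset)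
  then obtain w where w: "T - f = {w}" by (metis card_1_singletonE)
  have "w \<in> e" if e: "e \<subseteq> T" "card e = 2" "e \<noteq> f" for e
  proof (rule ccontr)
    assume "w \<notin> e"
    then have "e \<subseteq> f" using w e(1) by auto
    then show False using card_subset_eq[OF finf] fT e by simp
  qed
  then show ?thesis using that[of w] w by auto
qed

text \<open>
What the matching polynomial says about a graph that shares it with K(k, t; l).
\<close>
locale matching_numbers_of_K_graph =
  fixes H :: "'a sgraph" and k t l :: nat
  assumes fsg: "finite_simple_graph H"
    and n: "card (verts H) = k + t + 2"
    and m: "card (edges H) = k + t + l"
    and m2: "num_matchings H 2 + l = k * (l + t)"
    and m3: "num_matchings H 3 = 0"
    and l: "1 \<le> l" "l \<le> k"
    and balanced: "\<bar>int l + int t - int k\<bar> \<le> 1"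
begin

lemma finite_verts: "finite (verts H)"
  and edge: "e \<in> edges H \<Longrightarrow> e \<subseteq> verts H \<and> card e = 2"
  using fsg by (auto simp: finite_simple_graph_def)

lemma no_loop: "{u} \<notin> edges H"
  using edge[of "{u}"] by auto

lemma neighbours_subset_verts: "{x. {u, x} \<in> edges H} \<subseteq> verts H - {u}"
  using edge no_loop by auto

text \<open>
The edge uv, if present, is assigned to the star at u: this makes the two stars disjoint.
\<close>
lemma split_cover:
  assumes "u \<noteq> v" and cover: "\<And>e. e \<in> edges H \<Longrightarrow> u \<in> e \<or> v \<in> e"
  defines "P \<equiv> {x. {u, x} \<in> edges H}" and "Q \<equiv> {y. {v, y} \<in> edges H} - {u}"
  shows "edges H = star u P \<union> star v Q" and "u \<notin> P" "u \<notin> Q" "v \<notin> Q" "finite P" "finite Q"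
    and "P \<subseteq> verts H" "Q \<subseteq> verts H"
proof -
  have "e \<in> star u P \<union> star v Q" if e: "e \<in> edges H" for e
  proof -
    obtain x y where "e = {x, y}" using edge[OF e] by (metis card_2_iff)
    then show ?thesis using cover[OF e] e by (auto simp: P_def Q_def star_def insert_commute)
  qed
  then show "edges H = star u P \<union> star v Q"
    by (auto simp: P_def Q_def star_def)
  show sub: "P \<subseteq> verts H" "Q \<subseteq> verts H" and "u \<notin> P" "u \<notin> Q" "v \<notin> Q"
    using neighbours_subset_verts[of u] neighbours_subset_verts[of v] no_loop by (auto simp: P_def Q_def)
  show "finite P" "finite Q" using sub finite_verts finite_subset by auto
qed

text \<open>
The vertices u and v and their neighbours number p + q - c + 2, and H has k + t + 2 vertices, so c \<ge> l.
Then \<open>balanced_product\<close> applies, and with c = l these vertices are all vertices of H.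
\<close>
lemma isomorphic_if_nonadjacent_cover:
  assumes uv: "u \<in> verts H" "v \<in> verts H" "u \<noteq> v" "{u, v} \<notin> edges H"
    and cover: "\<And>e. e \<in> edges H \<Longrightarrow> u \<in> e \<or> v \<in> e"
  shows "isomorphic (K_graph k t l) H"
proof -
  define P Q where "P = {x. {u, x} \<in> edges H}" and "Q = {y. {v, y} \<in> edges H} - {u}"
  note PQ = split_cover[OF uv(3) cover, folded P_def Q_def]
  have vP: "v \<notin> P" using uv(4) by (simp add: P_def)
  note count = matchings_two_stars[OF PQ(1) uv(3) PQ(2-6)]
  define c where "c = card (P \<inter> Q)"
  have union: "card (P \<union> Q) + c = card P + card Q"
    unfolding c_def using card_Un_Int[OF PQ(5,6)] by simp
  have sub: "insert u (insert v (P \<union> Q)) \<subseteq> verts H" using uv PQ by auto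
  have card_sub: "card (insert u (insert v (P \<union> Q))) = card (P \<union> Q) + 2"
    using uv PQ vP by (simp add: card_insert_if)
  then have "card (P \<union> Q) \<le> k + t"
    using card_mono[OF finite_verts sub] n by linarith
  then have "l \<le> c" using union count(1) m by linarith
  moreover have prod: "card P * card Q + l = k * (l + t) + c"
    using count(2) m2 vP by (simp add: c_def)
  ultimately have "k * (l + t) \<le> card P * card Q" by linarith
  then have sizes: "card P = k \<and> card Q = l + t \<or> card P = l + t \<and> card Q = k"
    using balanced_product[of "card P" "card Q" k "l + t"] count(1) m balanced by auto
  then have c: "c = l" using prod by auto
  have "verts H = {u, v} \<union> P \<union> Q"
    using card_subset_eq[OF finite_verts sub] card_sub union c count(1) m n by auto
  then have V: "verts H = {u, v} \<union> P \<union> Q" "verts H = {v, u} \<union> Q \<union> P" by auto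
  have E: "edges H = star u P \<union> star v Q" "edges H = star v Q \<union> star u P" using PQ(1) by auto
  let ?L = "Leaf ` {1..k}" and ?R = "Pendant ` {1..t} \<union> Leaf ` {1..l}"
  have VK: "verts (K_graph k t l) = {Center, Hub} \<union> ?L \<union> ?R"
    using l(2) by (auto simp: K_graph_def)
  have K: "Center \<noteq> Hub" "Center \<notin> ?L \<union> ?R" "Hub \<notin> ?L \<union> ?R" "finite ?L" "finite ?R" by auto
  note cardK = card_K_graph_leaves[OF l(2)]
  have H: "u \<notin> P \<union> Q" "v \<notin> P \<union> Q" "u \<notin> Q \<union> P" "v \<notin> Q \<union> P" using PQ vP by auto
  from sizes show ?thesis
  proof
    assume s: "card P = k \<and> card Q = l + t"
    show ?thesis
      by (rule isomorphic_two_stars[OF VK V(1) K_graph_two_stars E(1) K uv(3) H(1,2) PQ(5,6)])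
        (use s c cardK in \<open>simp_all add: c_def\<close>)
  next
    assume s: "card P = l + t \<and> card Q = k"
    show ?thesis
      by (rule isomorphic_two_stars[OF VK V(2) K_graph_two_stars E(2) K uv(3)[symmetric] H(4,3) PQ(6,5)])
        (use s c cardK in \<open>simp_all add: c_def Int_commute\<close>)
  qed
qed

text \<open>
Only a cover by adjacent vertices u, v remains. By \<open>adjacent_cover_small\<close>, H is then a path with two
or three edges; replacing u or v by an end vertex of the path gives a nonadjacent cover.
\<close>
lemma isomorphic_if_two_cover:
  assumes "two_cover (edges H)"
  shows "isomorphic (K_graph k t l) H"
proof -
  obtain u0 v0 where cover0: "\<And>e. e \<in> edges H \<Longrightarrow> u0 \<in> e \<or> v0 \<in> e"
    using assms unfolding two_cover_def by blast
  have V: "card (verts H) \<ge> 2" using n by simp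
  \<comment> \<open>A covering vertex outside H covers nothing, so both can be replaced by distinct vertices of H.\<close>
  obtain u where u: "u \<in> verts H" "u0 \<in> verts H \<Longrightarrow> u = u0"
  proof (cases "u0 \<in> verts H")
    case False
    have "verts H \<noteq> {}" using V by auto
    then show ?thesis using that False by blast
  qed blast
  have "card (verts H - {u}) \<noteq> 0" using V u by simp
  then have "verts H - {u} \<noteq> {}" by (metis card.empty)
  then obtain w where w: "w \<in> verts H - {u}" by blast
  obtain v where v: "v \<in> verts H" "u \<noteq> v" "v0 \<in> verts H - {u} \<Longrightarrow> v = v0"
    using w by (cases "v0 \<in> verts H - {u}") auto
  have cover: "u \<in> e \<or> v \<in> e" if "e \<in> edges H" for e
    using cover0[OF that] edge[OF that] u v by blast
  show ?thesis
  proof (cases "{u, v} \<in> edges H")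
    case False
    then show ?thesis using isomorphic_if_nonadjacent_cover u v cover by blast
  next
    case True
    define P Q where "P = {x. {u, x} \<in> edges H}" and "Q = {y. {v, y} \<in> edges H} - {u}"
    note PQ = split_cover[OF v(2) cover, folded P_def Q_def]
    note count = matchings_two_stars[OF PQ(1) v(2) PQ(2-6)]
    define P' where "P' = P - {v}"
    have vP: "v \<in> P" using True by (simp add: P_def)
    have cardP: "card P = card P' + 1" using card.remove[OF PQ(5) vP] by (simp add: P'_def)
    have PQ': "P \<inter> Q = P' \<inter> Q" using PQ by (auto simp: P'_def)
    define c where "c = card (P' \<inter> Q)"
    have "finite P'" using PQ by (simp add: P'_def)
    then have union: "card (P' \<union> Q) + c = card P' + card Q"
      unfolding c_def using card_Un_Int[OF _ PQ(6)] by simp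
    have "insert u (insert v (P' \<union> Q)) \<subseteq> verts H" using u v PQ by (auto simp: P'_def)
    from card_mono[OF finite_verts this] have "card (P' \<union> Q) \<le> k + t"
      using u v PQ \<open>finite P'\<close> n by (simp add: card_insert_if P'_def)
    then have "l \<le> c + 1" using union count(1) m cardP by linarith
    moreover have "card P' * card Q + l = k * (l + t) + c"
      using count(2) m2 by (simp add: c_def PQ' P'_def)
    ultimately have small: "card P' \<le> 1" "card Q \<le> 1" "1 \<le> card P' + card Q" "c = 0"
      using adjacent_cover_small[of "card P'" "card Q" k "l + t" l c] count(1) m cardP l balanced
      by auto
    then have disj: "P' \<inter> Q = {}" using \<open>finite P'\<close> by (simp add: c_def)
    show ?thesis
    proof (cases "card P' = 1")
      case True
      then obtain x where x: "P' = {x}" by (metis card_1_singletonE)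
      then have xP: "x \<in> P" "x \<noteq> v" "x \<noteq> u" "P = {v, x}" "x \<notin> Q"
        using vP PQ disj by (auto simp: P'_def)
      show ?thesis
      \<comment> \<open>H consists of the edges xu and uv and perhaps one more edge at v.\<close>
      proof (rule isomorphic_if_nonadjacent_cover[of x v])
        show "{x, v} \<notin> edges H" using xP by (auto simp: Q_def insert_commute)
        fix e assume "e \<in> edges H"
        then have "e \<in> star u P \<union> star v Q" using PQ(1) by simp
        then show "x \<in> e \<or> v \<in> e" using xP by (auto simp: star_def)
      qed (use xP(1,2) PQ(7) v(1) in auto)
    next
      case False
      then have "card P' = 0" and Q: "card Q = 1" using small by linarith+
      then have P': "P' = {}" using \<open>finite P'\<close> by simp
      obtain y where y: "Q = {y}" using Q by (metis card_1_singletonE)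
      have P: "P = {v}" using P' vP by (auto simp: P'_def)
      have yP: "y \<noteq> u" "y \<noteq> v" "y \<notin> P" using y PQ P by auto
      show ?thesis
      \<comment> \<open>H is the path u, v, y.\<close>
      proof (rule isomorphic_if_nonadjacent_cover[of u y])
        show "{u, y} \<notin> edges H" using yP by (auto simp: P_def)
        fix e assume "e \<in> edges H"
        then have "e \<in> star u P \<union> star v Q" using PQ(1) by simp
        then show "u \<in> e \<or> y \<in> e" using P y by (auto simp: star_def)
      qed (use u(1) y yP(1) PQ(8) in auto)
    qed
  qed
qed

text \<open>
If an edge of the triangle on T were missing, its opposite vertex and v would cover all edges.
So the triangle is full, and the counting formulas feed \<open>star_triangle_arithmetic\<close>; the inequality
l \<le> s + 1 there comes from the number of vertices.
\<close>
lemma exceptional_if_star_triangle: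
  assumes T: "card T = 3" "v \<notin> T" and cover: "\<And>e. e \<in> edges H \<Longrightarrow> v \<in> e \<or> e \<subseteq> T"
    and nc: "\<not> two_cover (edges H)"
  shows "exceptional k t l"
proof -
  have full: "triangle T \<subseteq> edges H"
  proof
    fix f assume f: "f \<in> triangle T"
    show "f \<in> edges H"
    proof (rule ccontr)
      assume notin: "f \<notin> edges H"
      obtain w where w: "\<And>e. e \<subseteq> T \<Longrightarrow> card e = 2 \<Longrightarrow> e \<noteq> f \<Longrightarrow> w \<in> e"
        using triangle_avoiding_edge[OF T(1) f] by metis
      have "v \<in> e \<or> w \<in> e" if "e \<in> edges H" for e
        using w[of e] cover[OF that] edge[OF that] that notin by blast
      then show False using nc unfolding two_cover_def by blast
    qed
  qed
  define P where "P = {x. {v, x} \<in> edges H}"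
  have P: "v \<notin> P" "P \<subseteq> verts H" using neighbours_subset_verts[of v] no_loop by (auto simp: P_def)
  then have finP: "finite P" using finite_verts finite_subset by blast
  have E: "edges H = star v P \<union> triangle T"
  proof -
    have "e \<in> star v P \<union> triangle T" if e: "e \<in> edges H" for e
    proof -
      obtain x y where "e = {x, y}" using edge[OF e] by (metis card_2_iff)
      then show ?thesis using cover[OF e] e edge[OF e]
        by (auto simp: P_def triangle_def star_def insert_commute)
    qed
    then show ?thesis using full by (auto simp: P_def star_def)
  qed
  note count = matchings_star_triangle[OF E T P(1) finP]
  have TV: "T \<subseteq> verts H"
  proof
    obtain a b c where abc: "T = {a, b, c}" "a \<noteq> b" "a \<noteq> c" "b \<noteq> c" using T(1) by (metis card_3_iff)
    then have "{a, b} \<in> edges H" "{a, c} \<in> edges H" using full triangle_insert[of a b c] by auto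
    then show "x \<in> verts H" if "x \<in> T" for x using edge abc that by blast
  qed
  obtain x where x: "{v, x} \<in> edges H"
  proof (rule ccontr)
    assume "\<not> thesis"
    then have "P = {}" using that by (auto simp: P_def)
    obtain a b c where abc: "T = {a, b, c}" "a \<noteq> b" "a \<noteq> c" "b \<noteq> c" using T(1) by (metis card_3_iff)
    have "a \<in> e \<or> b \<in> e" if "e \<in> edges H" for e
      using that unfolding E \<open>P = {}\<close> using triangle_insert[of a b c] abc by (auto simp: star_def)
    then show False using nc unfolding two_cover_def by blast
  qed
  then have vV: "v \<in> verts H" using edge by blast
  define s where "s = card (P \<inter> T)"
  have finT: "finite T" using T(1) card_ge_0_finite by force
  have union: "card (P \<union> T) + s = card P + 3"
    unfolding s_def using card_Un_Int[OF finP finT] T(1) by simp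
  have "insert v (P \<union> T) \<subseteq> verts H" using vV P TV by auto
  from card_mono[OF finite_verts this] have "card (P \<union> T) + 1 \<le> k + t + 2"
    using P T finP finT n by (simp add: card_insert_if)
  then have "l \<le> s + 1" using union count(1) m by linarith
  moreover have "k + t + l = card P + 3" using count(1) m by simp
  moreover have "k * (l + t) + 2 * s = 3 * card P + l" using count(2) m2 by (simp add: s_def)
  ultimately show ?thesis
    using star_triangle_arithmetic[of k t l "card P" s] l balanced by blast
qed

text \<open>
If one of the triangles is not full, one vertex covers its edges and the previous shape is met.
Two full triangles would need k + b = 6 and k b = 9 + l > 9.
\<close>
lemma exceptional_if_two_triples:
  assumes ST: "card S = 3" "card T = 3" "S \<inter> T = {}"
    and cover: "\<And>e. e \<in> edges H \<Longrightarrow> e \<subseteq> S \<or> e \<subseteq> T" and nc: "\<not> two_cover (edges H)"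
  shows "exceptional k t l"
proof -
  have reduce: "exceptional k t l"
    if XY: "card X = 3" "card Y = 3" "X \<inter> Y = {}" "\<And>e. e \<in> edges H \<Longrightarrow> e \<subseteq> X \<or> e \<subseteq> Y"
      and f: "f \<in> triangle X" "f \<notin> edges H" for X Y f
  proof -
    obtain w where w: "w \<in> X" "\<And>e. e \<subseteq> X \<Longrightarrow> card e = 2 \<Longrightarrow> e \<noteq> f \<Longrightarrow> w \<in> e"
      using triangle_avoiding_edge[OF XY(1) f(1)] by metis
    have "w \<in> e \<or> e \<subseteq> Y" if "e \<in> edges H" for e
      using w(2)[of e] XY(4)[OF that] edge[OF that] that f(2) by blast
    moreover have "w \<notin> Y" using w(1) XY(3) by auto
    ultimately show ?thesis using exceptional_if_star_triangle[OF XY(2)] nc by blast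
  qed
  consider f where "f \<in> triangle S" "f \<notin> edges H" | f where "f \<in> triangle T" "f \<notin> edges H"
    | "triangle S \<union> triangle T \<subseteq> edges H" by blast
  then show ?thesis
  proof cases
    case 1
    then show ?thesis using reduce[of S T] ST cover by blast
  next
    case 2
    then show ?thesis using reduce[of T S] ST cover by blast
  next
    case 3
    have "edges H = triangle S \<union> triangle T"
      using 3 cover edge by (auto simp: triangle_def)
    note count = matchings_two_triangles[OF this ST]
    have "k + (l + t) = 6" "k * (l + t) = 9 + l" using count m m2 by linarith+
    moreover from this have "k * (l + t) \<le> 3 * 3"
      using balanced by (cases "k = 3") auto
    ultimately show ?thesis using l by simp
  qed
qed

text \<open>
Few vertices with few edges would have a cover by two vertices, which supplies the last hypothesis of
\<open>five_vertices_arithmetic\<close>.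
\<close>
lemma exceptional_if_five_vertices:
  assumes F: "finite F" "card F \<le> 5" "\<And>e. e \<in> edges H \<Longrightarrow> e \<subseteq> F"
    and nc: "\<not> two_cover (edges H)"
  shows "exceptional k t l"
proof -
  have F': "\<And>e. e \<in> edges H \<Longrightarrow> e \<subseteq> F \<and> card e = 2" using F(3) edge by blast
  note bounds = five_vertices_bounds[of F H, OF F(1,2) F', unfolded m]
  have "\<not> (card (verts H) \<le> 4 \<and> card (edges H) < 6)"
    using two_cover_four_vertices[OF finite_verts _ edge] nc by blast
  then have "5 \<le> k + t + 2 \<or> 6 \<le> k + t + l" unfolding n m by linarith
  then show ?thesis
    using five_vertices_arithmetic[OF l balanced bounds(1) bounds(2) m2] by blast
qed

lemma two_cover_or_exceptional: "two_cover (edges H) \<or> exceptional k t l"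
proof -
  have "False" if efg: "e \<in> edges H" "f \<in> edges H" "g \<in> edges H"
      "e \<inter> f = {}" "e \<inter> g = {}" "f \<inter> g = {}" for e f g
  proof -
    have "e \<noteq> {}" "f \<noteq> {}" using edge efg by force+
    then have "e \<noteq> f" "e \<noteq> g" "f \<noteq> g" using efg by auto
    then have "{e, f, g} \<in> matchings H 3"
      using efg by (auto simp: matchings_def disjoint_def Int_commute)
    then show False
      using m3 num_matchings_eq_0_iff[OF finite_edges[OF fsg]] by blast
  qed
  then have "small_matching_shape (edges H)"
    using shape_if_no_three_disjoint_edges[of "edges H"] edge by blast
  then consider "two_cover (edges H)"
    | v T where "card T = 3" "v \<notin> T" "\<forall>e\<in>edges H. v \<in> e \<or> e \<subseteq> T"
    | S T where "card S = 3" "card T = 3" "S \<inter> T = {}" "\<forall>e\<in>edges H. e \<subseteq> S \<or> e \<subseteq> T"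
    | F where "finite F" "card F \<le> 5" "\<forall>e\<in>edges H. e \<subseteq> F"
    unfolding small_matching_shape_def by (elim disjE exE conjE) blast+
  then show ?thesis
  proof cases
    case 2
    then show ?thesis using exceptional_if_star_triangle[of T v] by blast
  next
    case 3
    then show ?thesis using exceptional_if_two_triples[of S T] by blast
  next
    case 4
    then show ?thesis using exceptional_if_five_vertices[of F] by blast
  qed simp
qed

end

lemma matching_unique_unless_exceptional:
  assumes "1 \<le> l" "l \<le> k" "\<bar>int l + int t - int k\<bar> \<le> 1" "\<not> exceptional k t l"
  shows "matching_unique (K_graph k t l)"
proof -
  have "isomorphic (K_graph k t l) H"
    if H: "finite_simple_graph H" "matching_poly H = matching_poly (K_graph k t l)" for H :: "nat sgraph"
  proof -
    note K = finite_simple_graph_K_graph[OF assms(2), of t]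
    note count = K_graph_counts[OF assms(2), where t = t]
    have card: "card (verts H) = card (verts (K_graph k t l))"
      and num: "num_matchings H j = num_matchings (K_graph k t l) j" for j
      using H(2) matching_poly_eq_iff[OF K H(1)] by auto
    interpret matching_numbers_of_K_graph H k t l
      using H(1) card num[of 2] num[of 3] num[of "Suc 0"] count assms
      by unfold_locales (simp_all add: num_matchings_1)
    show ?thesis
      using two_cover_or_exceptional isomorphic_if_two_cover assms(4) by blast
  qed
  then show ?thesis unfolding matching_unique_def comatching_def by blast
qed

section \<open>Comatching graphs for the exceptional triples\<close>

lemma two_cover_K_graph: "two_cover (edges (K_graph k t l))"
  unfolding two_cover_def K_graph_two_stars by (rule exI[of _ Center], rule exI[of _ Hub]) (auto simp: star_def)

text \<open>
Being covered by two vertices is what distinguishes K(k, t; l) from the comatching graphs below.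
\<close>
lemma two_cover_isomorphic:
  assumes iso: "isomorphic G H" and G: "finite_simple_graph G" and H: "finite_simple_graph H"
    and "two_cover (edges G)"
  shows "two_cover (edges H)"
proof -
  obtain f where f: "bij_betw f (verts G) (verts H)"
    "\<And>x y. x \<in> verts G \<Longrightarrow> y \<in> verts G \<Longrightarrow> {x, y} \<in> edges G \<longleftrightarrow> {f x, f y} \<in> edges H"
    using iso unfolding isomorphic_def by blast
  obtain u v where cover: "\<And>e. e \<in> edges G \<Longrightarrow> u \<in> e \<or> v \<in> e"
    using assms(4) unfolding two_cover_def by blast
  have "f u \<in> e \<or> f v \<in> e" if e: "e \<in> edges H" for e
  proof -
    have "e \<subseteq> verts H" "card e = 2" using H e by (auto simp: finite_simple_graph_def)
    then obtain p q where pq: "e = {p, q}" "p \<in> verts H" "q \<in> verts H"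
      by (auto simp: card_2_iff)
    then obtain x y where xy: "x \<in> verts G" "y \<in> verts G" "p = f x" "q = f y"
      using f(1) unfolding bij_betw_def by blast
    then have "{x, y} \<in> edges G" using f(2) e pq by simp
    then show ?thesis using cover[of "{x, y}"] pq xy by auto
  qed
  then show ?thesis unfolding two_cover_def by blast
qed

lemma same_matching_polyI:
  assumes "l \<le> k" and H: "finite_simple_graph H" and n: "card (verts H) = k + t + 2"
    and m: "card (edges H) = k + t + l" and m2: "num_matchings H 2 + l = k * (l + t)"
    and m3: "\<And>j. 3 \<le> j \<Longrightarrow> num_matchings H j = 0"
  shows "matching_poly H = matching_poly (K_graph k t l)"
proof -
  note K = finite_simple_graph_K_graph[OF assms(1), of t]
  note count = K_graph_counts[OF assms(1), where t = t]
  have "num_matchings H j = num_matchings (K_graph k t l) j" for j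
  proof -
    consider "j = 0" | "j = Suc 0" | "j = 2" | "3 \<le> j" by linarith
    then show ?thesis
    proof cases
      case 1
      then show ?thesis
        using num_matchings_0[OF finite_edges[OF H]] num_matchings_0[OF finite_edges[OF K]] by simp
    next
      case 2
      then show ?thesis using num_matchings_1 m count(2) by metis
    next
      case 3
      then show ?thesis using m2 count(3) by simp
    next
      case 4
      then show ?thesis using m3 count(4) by simp
    qed
  qed
  then show ?thesis using matching_poly_eq_iff[OF K H] n count(1) by simp
qed

lemma not_matching_uniqueI:
  fixes H :: "nat sgraph"
  assumes "l \<le> k" and H: "finite_simple_graph H" and n: "card (verts H) = k + t + 2"
    and m: "card (edges H) = k + t + l" and m2: "num_matchings H 2 + l = k * (l + t)"
    and m3: "\<And>j. 3 \<le> j \<Longrightarrow> num_matchings H j = 0"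
    and nc: "\<not> two_cover (edges H)"
  shows "\<not> matching_unique (K_graph k t l)"
proof -
  have "\<not> isomorphic (K_graph k t l) H"
    using two_cover_isomorphic[OF _ finite_simple_graph_K_graph[OF assms(1)] H] two_cover_K_graph nc
    by blast
  then show ?thesis
    using same_matching_polyI[OF assms(1-6)] H unfolding matching_unique_def comatching_def by blast
qed

text \<open>
For s < d and s \<le> 3, the d neighbours of 0 form a segment that contains exactly s of the vertices
1, 2, 3 of the triangle and reaches beyond it, so that no vertex is isolated.
\<close>
definition star_triangle_graph :: "nat \<Rightarrow> nat \<Rightarrow> nat sgraph" where
  "star_triangle_graph d s =
    \<lparr> verts = {..<4 + d - s}, edges = star 0 {4 - s..<4 - s + d} \<union> triangle {1, 2, 3} \<rparr>"

lemma star_triangle_graph: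
  assumes "s < d" "s \<le> 3"
  shows "finite_simple_graph (star_triangle_graph d s)"
    and "card (verts (star_triangle_graph d s)) = 4 + d - s"
    and "card (edges (star_triangle_graph d s)) = d + 3"
    and "num_matchings (star_triangle_graph d s) 2 + 2 * s = 3 * d"
    and "3 \<le> j \<Longrightarrow> num_matchings (star_triangle_graph d s) j = 0"
    and "\<not> two_cover (edges (star_triangle_graph d s))"
proof -
  let ?P = "{4 - s..<4 - s + d}" and ?T = "{1, 2, 3} :: nat set"
  have E: "edges (star_triangle_graph d s) = star 0 ?P \<union> triangle ?T"
    by (simp add: star_triangle_graph_def)
  have "card ?T = 3" "0 \<notin> ?T" "0 \<notin> ?P" "finite ?P" using assms by auto
  note count = matchings_star_triangle[OF E this]
  show "finite_simple_graph (star_triangle_graph d s)"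
    using assms by (auto simp: finite_simple_graph_def star_triangle_graph_def star_def triangle_def)
  show "card (verts (star_triangle_graph d s)) = 4 + d - s"
    by (simp add: star_triangle_graph_def)
  show "card (edges (star_triangle_graph d s)) = d + 3" using count(1) by simp
  have "?P \<inter> ?T = {4 - s..<4}" using assms by auto
  then show "num_matchings (star_triangle_graph d s) 2 + 2 * s = 3 * d"
    using count(2) assms by simp
  show "3 \<le> j \<Longrightarrow> num_matchings (star_triangle_graph d s) j = 0" by (rule count(3))
  have a: "{0, 4} \<in> edges (star_triangle_graph d s)"
    unfolding E using assms by (auto simp: doubleton_in_star_iff)
  have b: "{1, 2} \<in> edges (star_triangle_graph d s)" "{1, 3} \<in> edges (star_triangle_graph d s)"
    "{2, 3} \<in> edges (star_triangle_graph d s)"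
    unfolding E using triangle_insert[of "1::nat" 2 3] by auto
  have False if cover: "\<forall>e\<in>edges (star_triangle_graph d s). u \<in> e \<or> v \<in> e" for u v
    using cover[THEN bspec, OF a] cover[THEN bspec, OF b(1)] cover[THEN bspec, OF b(2)]
      cover[THEN bspec, OF b(3)] by auto
  then show "\<not> two_cover (edges (star_triangle_graph d s))"
    unfolding two_cover_def by blast
qed

definition five_cycle :: "nat set set" where
  "five_cycle = {{0, 1}, {1, 2}, {2, 3}, {3, 4}, {4, 0}}"

lemma sum_lessThan_5: "(\<Sum>x<5. f x) = f 0 + f 1 + f 2 + f 3 + f (4::nat)"
  for f :: "nat \<Rightarrow> nat"
  by (simp add: eval_nat_numeral)

lemma filter_insert:
  "{e \<in> insert a A. P e} = (if P a then insert a {e \<in> A. P e} else {e \<in> A. P e})"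
  by auto

lemma not_two_cover_five_cycle: "five_cycle \<subseteq> E \<Longrightarrow> \<not> two_cover E"
proof
  assume "five_cycle \<subseteq> E" "two_cover E"
  then obtain u v where cover: "\<And>e. e \<in> five_cycle \<Longrightarrow> u \<in> e \<or> v \<in> e"
    unfolding two_cover_def by blast
  have "u \<in> {0, 1} \<or> v \<in> {0, 1}" "u \<in> {1, 2} \<or> v \<in> {1, 2}" "u \<in> {2, 3} \<or> v \<in> {2, 3}"
    "u \<in> {3, 4} \<or> v \<in> {3, 4}" "u \<in> {4, 0} \<or> v \<in> {4, 0}"
    by (rule cover, simp add: five_cycle_def)+
  then show False by (simp only: insert_iff empty_iff simp_thms) (elim disjE; simp)
qed

text \<open>
All five degrees on the cycle are 2, so the degree bound on the number of 2-matchings is attained.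
\<close>
lemma five_cycle_plus_vertex:
  defines "C \<equiv> \<lparr> verts = {..<6}, edges = five_cycle \<rparr>"
  shows "finite_simple_graph C" "card (verts C) = 6" "card (edges C) = 5" "num_matchings C 2 = 5"
    and "3 \<le> j \<Longrightarrow> num_matchings C j = 0" and "\<not> two_cover (edges C)"
proof -
  have E: "e \<subseteq> {..<5} \<and> card e = 2" if "e \<in> edges C" for e
    using that by (auto simp: C_def five_cycle_def)
  then show "finite_simple_graph C" by (fastforce simp: finite_simple_graph_def C_def)
  show "card (verts C) = 6" by (simp add: C_def)
  show m: "card (edges C) = 5" by (simp add: C_def five_cycle_def doubleton_eq_iff card_insert_if)
  have "(\<Sum>x<5. (card {e \<in> edges C. x \<in> e})\<^sup>2) = 20"
    unfolding sum_lessThan_5 C_def five_cycle_def sgraph.select_convs filter_insert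
    by (simp add: doubleton_eq_iff card_insert_if power2_eq_square)
  then show "num_matchings C 2 = 5"
    using degree_sums(2)[of "{..<5}" C, OF _ E] m by simp
  show "num_matchings C j = 0" if "3 \<le> j"
    by (rule num_matchings_zero_if_few_vertices[of "{..<5}"]) (use E that in auto)
  show "\<not> two_cover (edges C)" by (rule not_two_cover_five_cycle) (simp add: C_def)
qed

text \<open>
The chord gives the degrees 3, 2, 3, 2, 2, so again the degree bound is attained; K(3, 0; 3) is the
complete bipartite graph with parts of two and three vertices, with the same degrees.
\<close>
lemma house:
  defines "C \<equiv> \<lparr> verts = {..<5}, edges = insert {0, 2} five_cycle \<rparr>"
  shows "finite_simple_graph C" "card (verts C) = 5" "card (edges C) = 6" "num_matchings C 2 = 6"
    and "3 \<le> j \<Longrightarrow> num_matchings C j = 0" and "\<not> two_cover (edges C)"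
proof -
  have E: "e \<subseteq> {..<5} \<and> card e = 2" if "e \<in> edges C" for e
    using that by (auto simp: C_def five_cycle_def)
  then show "finite_simple_graph C" by (fastforce simp: finite_simple_graph_def C_def)
  show "card (verts C) = 5" by (simp add: C_def)
  show m: "card (edges C) = 6" by (simp add: C_def five_cycle_def doubleton_eq_iff card_insert_if)
  have "(\<Sum>x<5. (card {e \<in> edges C. x \<in> e})\<^sup>2) = 30"
    unfolding sum_lessThan_5 C_def five_cycle_def sgraph.select_convs filter_insert
    by (simp add: doubleton_eq_iff card_insert_if power2_eq_square)
  then show "num_matchings C 2 = 6"
    using degree_sums(2)[of "{..<5}" C, OF _ E] m by simp
  show "num_matchings C j = 0" if "3 \<le> j"
    by (rule num_matchings_zero_if_few_vertices[of "{..<5}"]) (use E that in auto)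
  show "\<not> two_cover (edges C)" by (rule not_two_cover_five_cycle) (auto simp: C_def)
qed

text \<open>
The parameters d and s of the star with triangle solve d + 3 = k + t + l and l = s + 1, the extremal
case of the inequality obtained from the number of vertices.
\<close>
lemma exceptional_not_unique:
  assumes "exceptional k t l"
  shows "\<not> matching_unique (K_graph k t l)"
proof -
  consider "(k, t, l) \<in> {(2, 1, 1), (2, 1, 2), (3, 0, 2), (3, 1, 2), (3, 2, 2), (4, 1, 2), (4, 3, 1)}"
    | "(k, t, l) \<in> {(2, 2, 1), (3, 1, 1)}" | "(k, t, l) = (3, 0, 3)"
    using assms by (auto simp: exceptional_def)
  then show ?thesis
  proof cases
    case 1
    then have ds: "l - 1 < k + t + l - 3" "l - 1 \<le> 3" by auto
    show ?thesis
      by (rule not_matching_uniqueI[OF _ star_triangle_graph(1)[OF ds] _ _ _ _ star_triangle_graph(6)[OF ds]])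
        (use 1 star_triangle_graph(2-5)[OF ds] in auto)
  next
    case 2
    then show ?thesis
      by (intro not_matching_uniqueI[OF _ five_cycle_plus_vertex(1) _ _ _ _ five_cycle_plus_vertex(6)])
        (use five_cycle_plus_vertex(2-5) in auto)
  next
    case 3
    then show ?thesis
      by (intro not_matching_uniqueI[OF _ house(1) _ _ _ _ house(6)]) (use house(2-5) in auto)
  qed
qed

section \<open>Matching uniqueness\<close>

theorem theorem10:
  fixes k t l :: nat
  assumes "k \<ge> 1" and "1 \<le> l" and "l \<le> k"
    and "\<bar>int l + int t - int k\<bar> \<le> 1"
  shows "matching_unique (K_graph k t l) \<longleftrightarrow>
    (k, t, l) \<notin> {(2, 1, 1), (2, 1, 2), (2, 2, 1), (3, 0, 2), (3, 1, 1), (3, 1, 2),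
                  (3, 2, 2), (3, 0, 3), (4, 1, 2), (4, 3, 1)}"
proof -
  have "matching_unique (K_graph k t l) \<longleftrightarrow> \<not> exceptional k t l"
    using matching_unique_unless_exceptional exceptional_not_unique assms by blast
  then show ?thesis unfolding exceptional_def .
qed

end
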